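(* Let $E$ be a graph and $K$ a field. Then $E$ satisfies Condition (K) if and only if every ideal in the Leavitt path algebra $L_K(E)$ is graded.
   Context: Algebras are not assumed commutative or unital, and ideals are two-sided. A graph $E=(E^0,E^1,r,s)$ is a directed graph with countable vertex set $E^0$, countable edge set $E^1$, and range and source maps $r,s:E^1\to E^0$. A vertex $v$ is regular ($v\in E^0_{\mathrm{reg}}$) if $0<|s^{-1}(v)|<\infty$. A path of length $n\ge1$ is $\alpha=e_1\cdots e_n$ with $r(e_i)=s(e_{i+1})$; $|\alpha|=n$, $s(\alpha)=s(e_1)$, $r(\alpha)=r(e_n)$; vertices are paths of length $0$; $E^*$ is the set of finite paths; $\alpha^*:=e_n^*\cdots e_1^*$, $v^*:=v$. $L_K(E)$ is the universal $K$-algebra generated by pairwise orthogonal idempotents $\{v:v\in E^0\}$ and elements $\{e,e^*:e\in E^1\}$ satisfying (1) $s(e)e=er(e)=e$; (2) $r(e)e^*=e^*s(e)=e^*$; (3) $e^*f=\delta_{e,f}r(e)$ for all $e,f\in E^1$; (4) $v=\sum_{s(e)=v}ee^*$ for all $v\in E^0_{\mathrm{reg}}$. It is $\mathbb{Z}$-graded with $L_K(E)_n$ the span of the $\alpha\beta^*$ ($\alpha,\beta\in E^*$) with $|\alpha|-|\beta|=n$. An ideal $I$ is graded if $I=\bigoplus_{n\in\mathbb{Z}}(I\cap L_K(E)_n)$. A closed path based at $v$ is a path $\alpha=e_1\cdots e_n$, $n\ge1$, with $r(\alpha)=s(\alpha)=v$. It is simple if $s(e_i)\neq s(e_1)$ for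 $i=2,\dots,n$. $E$ satisfies Condition (K) if every vertex in $E^0$ is either the base of no closed path or the base of at least two simple closed paths. *)

theory Defs
  imports
    "HOL-Algebra.QuotRing"
    "HOL-Algebra.Module"
    "HOL-Library.Poly_Mapping"
    "HOL-Library.Countable_Set"
    "Graph_Theory.Arc_Walk"
begin

text \<open>
  Graphs are \<open>pre_digraph\<close>s: \<open>tail\<close> is the source map and \<open>head\<close> the range map, and
  \<open>pre_digraph.awalk E u p v\<close> says that the arc list \<open>p\<close> is a path from \<open>u\<close> to \<open>v\<close>,
  the empty list being the path of length 0 at the vertex \<open>u = v\<close>.
\<close>

section \<open>Condition (K)\<close>

definition closed_path :: "('v, 'e) pre_digraph \<Rightarrow> 'v \<Rightarrow> 'e list \<Rightarrow> bool" where
  "closed_path E v p \<longleftrightarrow> p \<noteq> [] \<and> pre_digraph.awalk E v p v"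

definition simple_closed_path :: "('v, 'e) pre_digraph \<Rightarrow> 'v \<Rightarrow> 'e list \<Rightarrow> bool" where
  "simple_closed_path E v p \<longleftrightarrow>
     closed_path E v p \<and> (\<forall>e\<in>set (tl p). tail E e \<noteq> tail E (hd p))"

definition condition_K :: "('v, 'e) pre_digraph \<Rightarrow> bool" where
  "condition_K E \<longleftrightarrow> (\<forall>v\<in>verts E.
     (\<nexists>p. closed_path E v p) \<or>
     (\<exists>p q. p \<noteq> q \<and> simple_closed_path E v p \<and> simple_closed_path E v q))"

definition regular_vertices :: "('v, 'e) pre_digraph \<Rightarrow> 'v set" where
  "regular_vertices E = {v \<in> verts E. out_arcs E v \<noteq> {} \<and> finite (out_arcs E v)}"

section \<open>Algebras that need not be commutative or unital\<close>

text \<open>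
  Algebras over the field given by the type \<open>'k\<close> are carried by the record type
  \<open>('k, 'a) module\<close>. As they need not be unital, the field \<open>one\<close> has no meaning
  here and is left \<open>undefined\<close>; nothing below refers to it.
\<close>

definition linear_subspace :: "('k::field, 'a) module \<Rightarrow> 'a set \<Rightarrow> bool" where
  "linear_subspace A W \<longleftrightarrow>
     W \<subseteq> carrier A \<and> \<zero>\<^bsub>A\<^esub> \<in> W \<and>
     (\<forall>x\<in>W. \<forall>y\<in>W. x \<oplus>\<^bsub>A\<^esub> y \<in> W) \<and> (\<forall>c. \<forall>x\<in>W. c \<odot>\<^bsub>A\<^esub> x \<in> W)"

definition linear_span :: "('k::field, 'a) module \<Rightarrow> 'a set \<Rightarrow> 'a set" where
  "linear_span A S = \<Inter>{W. linear_subspace A W \<and> S \<subseteq> W}"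

definition algebra_ideal :: "('k::field, 'a) module \<Rightarrow> 'a set \<Rightarrow> bool" where
  "algebra_ideal A I \<longleftrightarrow>
     linear_subspace A I \<and>
     (\<forall>a\<in>carrier A. \<forall>x\<in>I. a \<otimes>\<^bsub>A\<^esub> x \<in> I \<and> x \<otimes>\<^bsub>A\<^esub> a \<in> I)"

definition generated_ideal :: "('k::field, 'a) module \<Rightarrow> 'a set \<Rightarrow> 'a set" where
  "generated_ideal A S = \<Inter>{I. algebra_ideal A I \<and> S \<subseteq> I}"

definition quotient_algebra :: "('k::field, 'a) module \<Rightarrow> 'a set \<Rightarrow> ('k, 'a set) module" where
  "quotient_algebra A J =
     \<lparr>carrier = a_rcosets\<^bsub>A\<^esub> J, mult = rcoset_mult A J, one = undefined,
      zero = J, add = set_add A,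
      smult = (\<lambda>c X. \<Union>x\<in>X. J +>\<^bsub>A\<^esub> (c \<odot>\<^bsub>A\<^esub> x))\<rparr>"

definition internal_direct_sum :: "('k::field, 'a) module \<Rightarrow> 'a set \<Rightarrow> (int \<Rightarrow> 'a set) \<Rightarrow> bool" where
  "internal_direct_sum A I W \<longleftrightarrow>
     I = {(\<Oplus>\<^bsub>A\<^esub>n\<in>N. x n) | N x. finite N \<and> (\<forall>n\<in>N. x n \<in> W n)} \<and>
     (\<forall>N x. finite N \<and> (\<forall>n\<in>N. x n \<in> W n) \<and> (\<Oplus>\<^bsub>A\<^esub>n\<in>N. x n) = \<zero>\<^bsub>A\<^esub>
        \<longrightarrow> (\<forall>n\<in>N. x n = \<zero>\<^bsub>A\<^esub>))"

definition graded_ideal ::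
  "('k::field, 'a) module \<Rightarrow> (int \<Rightarrow> 'a set) \<Rightarrow> 'a set \<Rightarrow> bool" where
  "graded_ideal A H I \<longleftrightarrow> algebra_ideal A I \<and> internal_direct_sum A I (\<lambda>n. I \<inter> H n)"

section \<open>Free algebras\<close>

datatype 'g free_word = Word (letters: "'g list")

instantiation free_word :: (type) monoid_add
begin

definition zero_free_word :: "'a free_word" where
  "0 = Word []"

definition plus_free_word :: "'a free_word \<Rightarrow> 'a free_word \<Rightarrow> 'a free_word" where
  "u + w = Word (letters u @ letters w)"

instance
  by standard (simp_all add: zero_free_word_def plus_free_word_def)

end

text \<open>
  The multiplication of \<open>'g free_word \<Rightarrow>\<^sub>0 'k\<close> is convolution, so this type is the unital
  free algebra on \<open>'g\<close>. The free algebra on \<open>X\<close> (without unit) consists of the elements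
  supported on nonempty words in letters from \<open>X\<close>.
\<close>

definition free_algebra :: "'g set \<Rightarrow> ('k::field, 'g free_word \<Rightarrow>\<^sub>0 'k) module" where
  "free_algebra X =
     \<lparr>carrier = {p. \<forall>w \<in> Poly_Mapping.keys p. letters w \<noteq> [] \<and> set (letters w) \<subseteq> X},
      mult = (*), one = undefined, zero = 0, add = (+),
      smult = (\<lambda>c. Poly_Mapping.map (\<lambda>a. c * a))\<rparr>"

abbreviation monomial :: "'g list \<Rightarrow> 'g free_word \<Rightarrow>\<^sub>0 'k::field" where
  "monomial xs \<equiv> Poly_Mapping.single (Word xs) 1"

section \<open>Leavitt path algebras\<close>

datatype ('v, 'e) lpa_gen = Vertex 'v | Edge 'e | Ghost 'e

type_synonym ('v, 'e, 'k) lpa_free = "('v, 'e) lpa_gen free_word \<Rightarrow>\<^sub>0 'k"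
type_synonym ('v, 'e, 'k) lpa = "('v, 'e, 'k) lpa_free set"

definition lpa_gens :: "('v, 'e) pre_digraph \<Rightarrow> ('v, 'e) lpa_gen set" where
  "lpa_gens E = Vertex ` verts E \<union> Edge ` arcs E \<union> Ghost ` arcs E"

abbreviation lpa_free_algebra ::
  "('v, 'e) pre_digraph \<Rightarrow> ('k::field, ('v, 'e, 'k) lpa_free) module" where
  "lpa_free_algebra E \<equiv> free_algebra (lpa_gens E)"

definition lpa_relators :: "('v, 'e) pre_digraph \<Rightarrow> ('v, 'e, 'k::field) lpa_free set" where
  "lpa_relators E =
     {monomial [Vertex v, Vertex w] - (if v = w then monomial [Vertex v] else 0) | v w.
        v \<in> verts E \<and> w \<in> verts E} \<union>
     {monomial [Vertex (tail E e), Edge e] - monomial [Edge e] | e. e \<in> arcs E} \<union>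
     {monomial [Edge e, Vertex (head E e)] - monomial [Edge e] | e. e \<in> arcs E} \<union>
     {monomial [Vertex (head E e), Ghost e] - monomial [Ghost e] | e. e \<in> arcs E} \<union>
     {monomial [Ghost e, Vertex (tail E e)] - monomial [Ghost e] | e. e \<in> arcs E} \<union>
     {monomial [Ghost e, Edge f] - (if e = f then monomial [Vertex (head E e)] else 0) | e f.
        e \<in> arcs E \<and> f \<in> arcs E} \<union>
     {monomial [Vertex v] - (\<Sum>e\<in>out_arcs E v. monomial [Edge e, Ghost e]) | v.
        v \<in> regular_vertices E}"

definition lpa_relation_ideal :: "('v, 'e) pre_digraph \<Rightarrow> ('v, 'e, 'k::field) lpa_free set" where
  "lpa_relation_ideal E = generated_ideal (lpa_free_algebra E) (lpa_relators E)"

definition leavitt_path_algebra ::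
  "('v, 'e) pre_digraph \<Rightarrow> ('k::field, ('v, 'e, 'k) lpa) module" where
  "leavitt_path_algebra E = quotient_algebra (lpa_free_algebra E) (lpa_relation_ideal E)"

definition lpa_class ::
  "('v, 'e) pre_digraph \<Rightarrow> ('v, 'e, 'k::field) lpa_free \<Rightarrow> ('v, 'e, 'k) lpa" where
  "lpa_class E x = lpa_relation_ideal E +>\<^bsub>lpa_free_algebra E\<^esub> x"

text \<open>
  The elements \<open>\<alpha>\<close> and \<open>\<alpha>\<^sup>*\<close> for the path \<open>\<alpha>\<close> with arc list \<open>p\<close>; the vertex \<open>u\<close> is
  used only for the path of length 0 at \<open>u\<close>.
\<close>

definition lpa_path :: "('v, 'e) pre_digraph \<Rightarrow> 'v \<Rightarrow> 'e list \<Rightarrow> ('v, 'e, 'k::field) lpa" where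
  "lpa_path E u p = lpa_class E (monomial (if p = [] then [Vertex u] else map Edge p))"

definition lpa_ghost_path ::
  "('v, 'e) pre_digraph \<Rightarrow> 'v \<Rightarrow> 'e list \<Rightarrow> ('v, 'e, 'k::field) lpa" where
  "lpa_ghost_path E u p = lpa_class E (monomial (if p = [] then [Vertex u] else map Ghost (rev p)))"

definition lpa_component :: "('v, 'e) pre_digraph \<Rightarrow> int \<Rightarrow> ('v, 'e, 'k::field) lpa set" where
  "lpa_component E n = linear_span (leavitt_path_algebra E)
     {lpa_path E u p \<otimes>\<^bsub>leavitt_path_algebra E\<^esub> lpa_ghost_path E u' q | u p v u' q v'.
        pre_digraph.awalk E u p v \<and> pre_digraph.awalk E u' q v' \<and>
        int (length p) - int (length q) = n}"

end

theory Submission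
  imports Defs
begin

text \<open>
  For an ideal \<open>N\<close> let \<open>J\<close> be its graded part, the set of all elements whose homogeneous
  components belong to \<open>N\<close>. Then \<open>J\<close> is an ideal inside \<open>N\<close> that contains every homogeneous
  element of \<open>N\<close>, and \<open>N\<close> is graded if and only if \<open>N = J\<close>.

  Suppose that Condition (K) holds and calculate modulo \<open>J\<close>. Let first \<open>x \<in> N\<close> be a nonzero
  combination of paths with range \<open>w\<close>. Multiplication by \<open>\<alpha>\<^sup>*\<close>, where \<open>\<alpha>\<close> is a shortest path that
  occurs in \<open>x\<close>, turns \<open>x\<close> into \<open>w + z\<close> up to a scalar, where \<open>z\<close> is a combination of closed paths
  of positive length based at \<open>w\<close> (\<open>divide_by_shortest_path\<close>). If \<open>z \<noteq> 0\<close>, there are two simple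
  closed paths \<open>c \<noteq> d\<close> at \<open>w\<close>. They are not initial segments of each other, and so \<open>\<gamma> = c\<^sup>m d\<close>
  with large \<open>m\<close> satisfies \<open>\<gamma>\<^sup>* z \<gamma> = 0\<close> although \<open>\<gamma>\<^sup>* \<gamma> = w\<close> (\<open>closed_paths_removable\<close>). Hence
  \<open>w \<in> N\<close>; but \<open>w\<close> is homogeneous, so \<open>w \<in> J\<close> and \<open>x = x w \<in> J\<close>.

  Any \<open>x \<in> N\<close> is a sum of elements \<open>x w\<close>, which are combinations of products \<open>\<alpha> \<beta>\<^sup>*\<close> where \<open>\<beta>\<close>
  starts at \<open>w\<close>. An induction on the length of these \<open>\<beta>\<close> reduces to the case that \<open>x f \<in> J\<close> for every
  edge \<open>f\<close> that leaves \<open>w\<close>. In that case \<open>x\<close> equals \<open>x\<^sub>0 g\<close> modulo \<open>J\<close>, where \<open>x\<^sub>0\<close> is a combination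
  of paths and \<open>g = w - (\<Sum>e\<in>F. e e\<^sup>*)\<close> for any sufficiently large finite set \<open>F\<close> of edges that leave
  \<open>w\<close>. The division by a shortest path now produces \<open>g\<close> itself, because \<open>g\<close> annihilates the closed
  paths whose first edge is in \<open>F\<close>. So \<open>g \<in> N\<close>, hence \<open>g \<in> J\<close> and \<open>x \<in> J\<close>
  (\<open>normal_negligible_step\<close>).

  Suppose that Condition (K) fails at \<open>v\<close>: there is exactly one simple closed path \<open>c\<close> at \<open>v\<close>. The
  algebra acts on the functions on those infinite paths that visit \<open>v\<close> infinitely often. The only
  such path that starts at \<open>v\<close> is \<open>c c c \<dots>\<close>, and so \<open>v - c\<close> acts as zero while its component \<open>v\<close> of
  degree 0 does not. The annihilator of this representation is therefore not graded
  (\<open>not_condition_K_component_open\<close>).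

  Both arguments are carried out in the free algebra, with ideals that contain the relators;
  \<open>graded_ideal_image_iff\<close> carries them over to the quotient.
\<close>

section \<open>Polynomials in free words\<close>

abbreviation scalar :: "'k::field \<Rightarrow> 'g free_word \<Rightarrow>\<^sub>0 'k" where
  "scalar c \<equiv> Poly_Mapping.single 0 c"

lemma sum_single_lookup: "(\<Sum>k\<in>Poly_Mapping.keys x. Poly_Mapping.single k (Poly_Mapping.lookup x k)) = (x :: 'g \<Rightarrow>\<^sub>0 'k::field)"
  by (rule poly_mapping_eqI) (auto simp: lookup_sum lookup_single when_def in_keys_iff)

lemma poly_mapping_linear_induct [case_names zero add single]:
  fixes x :: "'g \<Rightarrow>\<^sub>0 'k::field"
  assumes "P 0" and "\<And>x y. P x \<Longrightarrow> P y \<Longrightarrow> P (x + y)"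
    and "\<And>k c. k \<in> Poly_Mapping.keys x \<Longrightarrow> P (Poly_Mapping.single k c)"
  shows "P x"
proof -
  have "P (\<Sum>k\<in>K. Poly_Mapping.single k (Poly_Mapping.lookup x k))"
    if "K \<subseteq> Poly_Mapping.keys x" for K
    using finite_subset[OF that finite_keys] that
    by (induction K rule: finite_induct) (auto intro: assms)
  then show ?thesis by (metis sum_single_lookup order_refl)
qed

lemma monomial_mult: "monomial xs * monomial ys = monomial (xs @ ys)"
  by (simp add: mult_single plus_free_word_def)


lemma scalar_mult_single: "scalar c * Poly_Mapping.single k d = Poly_Mapping.single k (c * d)"
  by (simp add: mult_single)

lemma single_eq_scalar_monomial: "Poly_Mapping.single k c = scalar c * monomial (letters k)"
  by (simp add: scalar_mult_single)

lemma scalar_central: "x * scalar c = scalar c * (x :: 'g free_word \<Rightarrow>\<^sub>0 'k::field)"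
  by (induction x rule: poly_mapping_linear_induct)
    (simp_all add: algebra_simps mult_single)

lemma scalar_left_commute: "x * (scalar c * y) = scalar c * (x * (y :: 'g free_word \<Rightarrow>\<^sub>0 'k::field))"
  by (metis mult.assoc scalar_central)

lemma scalar_inverse: "c \<noteq> 0 \<Longrightarrow> scalar (inverse c) * (scalar c * x) = x"
  by (simp add: mult.assoc[symmetric] mult_single)

lemma scalar_minus_one: "scalar (- 1) * x = - x"
  by (simp add: single_uminus)

lemma lookup_scalar_mult: "Poly_Mapping.lookup (scalar c * x) k = c * Poly_Mapping.lookup x k"
  by (induction x rule: poly_mapping_linear_induct)
    (simp_all add: lookup_add algebra_simps mult_single lookup_single when_def)

lemma keys_scalar_mult: "Poly_Mapping.keys (scalar c * x) \<subseteq> Poly_Mapping.keys x"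
  by (auto simp: in_keys_iff lookup_scalar_mult)

lemma keys_add_subset: "Poly_Mapping.keys x \<subseteq> Q \<Longrightarrow> Poly_Mapping.keys y \<subseteq> Q \<Longrightarrow> Poly_Mapping.keys (x + y) \<subseteq> Q"
  using keys_add[of x y] by blast

text \<open>
  Homogeneous components and the projection onto the words in a given alphabet are both of this
  form.
\<close>

definition part :: "('g free_word \<Rightarrow> bool) \<Rightarrow> ('g free_word \<Rightarrow>\<^sub>0 'k::field) \<Rightarrow> 'g free_word \<Rightarrow>\<^sub>0 'k" where
  "part P x = Poly_Mapping.mapp (\<lambda>k c. if P k then c else 0) x"

lemma lookup_part: "Poly_Mapping.lookup (part P x) k = (if P k then Poly_Mapping.lookup x k else 0)"
  by (simp add: part_def lookup_mapp when_def in_keys_iff)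

lemma keys_part: "Poly_Mapping.keys (part P x) = {k \<in> Poly_Mapping.keys x. P k}"
  by (auto simp: in_keys_iff lookup_part split: if_splits)

lemma part_add [simp]: "part P (x + y) = part P x + part P y"
  by (rule poly_mapping_eqI) (simp add: lookup_part lookup_add)

lemma part_zero [simp]: "part P 0 = 0"
  by (rule poly_mapping_eqI) (simp add: lookup_part)

lemma part_minus [simp]: "part P (x - y) = part P x - part P y"
  by (rule poly_mapping_eqI) (simp add: lookup_part lookup_minus)

lemma part_sum [simp]: "part P (\<Sum>i\<in>A. f i) = (\<Sum>i\<in>A. part P (f i))"
  by (induction A rule: infinite_finite_induct) simp_all

lemma part_single: "part P (Poly_Mapping.single k c) = (if P k then Poly_Mapping.single k c else 0)"
  by (rule poly_mapping_eqI) (auto simp: lookup_part lookup_single when_def)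

lemma part_eq_self: "(\<And>k. k \<in> Poly_Mapping.keys x \<Longrightarrow> P k) \<Longrightarrow> part P x = x"
  by (rule poly_mapping_eqI) (auto simp: lookup_part in_keys_iff)

lemma part_eq_0: "(\<And>k. k \<in> Poly_Mapping.keys x \<Longrightarrow> \<not> P k) \<Longrightarrow> part P x = 0"
  by (rule poly_mapping_eqI) (auto simp: lookup_part in_keys_iff)

text \<open>
  The condition \<open>Q\<close> is \<open>P\<close> as seen after the word \<open>w\<close> has been split off: a shifted degree, or the
  constant \<open>False\<close> if \<open>w\<close> contains a forbidden letter.
\<close>

lemma part_single_mult:
  assumes "\<And>k. P (w + k) \<longleftrightarrow> Q k"
  shows "part P (Poly_Mapping.single w c * x) = Poly_Mapping.single w c * part Q x"
  by (induction x rule: poly_mapping_linear_induct)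
    (simp_all add: algebra_simps mult_single part_single assms)

lemma part_mult_single:
  assumes "\<And>k. P (k + w) \<longleftrightarrow> Q k"
  shows "part P (x * Poly_Mapping.single w c) = part Q x * Poly_Mapping.single w c"
  by (induction x rule: poly_mapping_linear_induct)
    (simp_all add: algebra_simps mult_single part_single assms)

definition two_sided_ideal :: "('g free_word \<Rightarrow>\<^sub>0 'k::field) set \<Rightarrow> bool" where
  "two_sided_ideal J \<longleftrightarrow> 0 \<in> J \<and> (\<forall>x\<in>J. \<forall>y\<in>J. x + y \<in> J) \<and> (\<forall>x\<in>J. \<forall>a. a * x \<in> J \<and> x * a \<in> J)"

lemma two_sided_idealI:
  assumes "0 \<in> J" and add: "\<And>x y. x \<in> J \<Longrightarrow> y \<in> J \<Longrightarrow> x + y \<in> J"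
    and left: "\<And>x k c. x \<in> J \<Longrightarrow> Poly_Mapping.single k c * x \<in> J"
    and right: "\<And>x k c. x \<in> J \<Longrightarrow> x * Poly_Mapping.single k c \<in> J"
  shows "two_sided_ideal J"
proof -
  have "a * x \<in> J \<and> x * a \<in> J" if "x \<in> J" for a x
    by (induction a rule: poly_mapping_linear_induct)
      (use that assms in \<open>auto simp: algebra_simps\<close>)
  then show ?thesis using assms by (auto simp: two_sided_ideal_def)
qed

context
  fixes J :: "('g free_word \<Rightarrow>\<^sub>0 'k::field) set"
  assumes J: "two_sided_ideal J"
begin

lemma two_sided_ideal_zero: "0 \<in> J"
  and two_sided_ideal_add: "x \<in> J \<Longrightarrow> y \<in> J \<Longrightarrow> x + y \<in> J"
  and two_sided_ideal_left: "x \<in> J \<Longrightarrow> a * x \<in> J"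
  and two_sided_ideal_right: "x \<in> J \<Longrightarrow> x * a \<in> J"
  using J by (auto simp: two_sided_ideal_def)

lemma two_sided_ideal_uminus: "x \<in> J \<Longrightarrow> - x \<in> J"
  using two_sided_ideal_left[of x "- 1"] by simp

lemma two_sided_ideal_diff: "x \<in> J \<Longrightarrow> y \<in> J \<Longrightarrow> x - y \<in> J"
  using two_sided_ideal_add[of x "- y"] two_sided_ideal_uminus[of y] by simp

lemma two_sided_ideal_sum: "(\<And>i. i \<in> A \<Longrightarrow> f i \<in> J) \<Longrightarrow> (\<Sum>i\<in>A. f i) \<in> J"
  by (induction A rule: infinite_finite_induct)
    (auto intro: two_sided_ideal_zero two_sided_ideal_add)

end

section \<open>Calculating modulo the Leavitt relations\<close>

abbreviation vertex_el :: "'v \<Rightarrow> ('v, 'e, 'k::field) lpa_free" where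
  "vertex_el v \<equiv> monomial [Vertex v]"

abbreviation edge_el :: "'e \<Rightarrow> ('v, 'e, 'k::field) lpa_free" where
  "edge_el e \<equiv> monomial [Edge e]"

abbreviation ghost_el :: "'e \<Rightarrow> ('v, 'e, 'k::field) lpa_free" where
  "ghost_el e \<equiv> monomial [Ghost e]"

text \<open>
  The range is kept as a last letter, so that the path of length 0 at \<open>w\<close> is no special case.
\<close>

definition path_el :: "'e list \<Rightarrow> 'v \<Rightarrow> ('v, 'e, 'k::field) lpa_free" where
  "path_el p w = monomial (map Edge p @ [Vertex w])"

definition ghost_path_el :: "'v \<Rightarrow> 'e list \<Rightarrow> ('v, 'e, 'k::field) lpa_free" where
  "ghost_path_el w p = monomial (Vertex w # map Ghost (rev p))"

lemma path_el_Nil: "path_el [] w = vertex_el w"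
  by (simp add: path_el_def)

lemma path_el_Cons: "path_el (e # p) w = edge_el e * path_el p w"
  by (simp add: path_el_def monomial_mult)

lemma ghost_path_el_Nil: "ghost_path_el w [] = vertex_el w"
  by (simp add: ghost_path_el_def)

lemma ghost_path_el_Cons: "ghost_path_el w (e # p) = ghost_path_el w p * ghost_el e"
  by (simp add: ghost_path_el_def monomial_mult)

lemma relator_vertex: "v \<in> verts E \<Longrightarrow> w \<in> verts E \<Longrightarrow>
    monomial [Vertex v, Vertex w] - (if v = w then monomial [Vertex v] else 0) \<in> lpa_relators E"
  and relator_tail_edge: "e \<in> arcs E \<Longrightarrow>
    monomial [Vertex (tail E e), Edge e] - monomial [Edge e] \<in> lpa_relators E"
  and relator_edge_head: "e \<in> arcs E \<Longrightarrow>
    monomial [Edge e, Vertex (head E e)] - monomial [Edge e] \<in> lpa_relators E"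
  and relator_head_ghost: "e \<in> arcs E \<Longrightarrow>
    monomial [Vertex (head E e), Ghost e] - monomial [Ghost e] \<in> lpa_relators E"
  and relator_ghost_tail: "e \<in> arcs E \<Longrightarrow>
    monomial [Ghost e, Vertex (tail E e)] - monomial [Ghost e] \<in> lpa_relators E"
  and relator_ghost_edge: "e \<in> arcs E \<Longrightarrow> f \<in> arcs E \<Longrightarrow>
    monomial [Ghost e, Edge f] - (if e = f then monomial [Vertex (head E e)] else 0) \<in> lpa_relators E"
  unfolding lpa_relators_def by blast+

text \<open>
  An ideal of the free algebra on the generators of \<open>L\<^sub>K(E)\<close> is enlarged to an ideal of the ring of
  all polynomials by adding the letters that do not come from the graph. Congruences can then be
  multiplied by arbitrary elements, the unit included, without membership conditions.
\<close>

locale lpa_congruence = wf_digraph E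
  for E :: "('v, 'e) pre_digraph" +
  fixes J :: "('v, 'e, 'k::field) lpa_free set"
  assumes J_ideal: "two_sided_ideal J"
    and J_relators: "lpa_relators E \<subseteq> J"
    and J_outside: "g \<notin> lpa_gens E \<Longrightarrow> monomial [g] \<in> J"
begin

definition cong :: "('v, 'e, 'k) lpa_free \<Rightarrow> ('v, 'e, 'k) lpa_free \<Rightarrow> bool" (infix \<open>\<approx>\<close> 50) where
  "x \<approx> y \<longleftrightarrow> x - y \<in> J"

lemma cong_refl [simp, intro]: "x \<approx> x"
  by (simp add: cong_def two_sided_ideal_zero[OF J_ideal])

lemma cong_sym: "x \<approx> y \<Longrightarrow> y \<approx> x"
  unfolding cong_def using two_sided_ideal_uminus[OF J_ideal, of "x - y"] by simp

lemma cong_trans [trans]: "x \<approx> y \<Longrightarrow> y \<approx> z \<Longrightarrow> x \<approx> z"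
  unfolding cong_def using two_sided_ideal_add[OF J_ideal, of "x - y" "y - z"] by simp

lemma cong_add: "x \<approx> x' \<Longrightarrow> y \<approx> y' \<Longrightarrow> x + y \<approx> x' + y'"
  unfolding cong_def using two_sided_ideal_add[OF J_ideal, of "x - x'" "y - y'"]
  by (simp add: algebra_simps)

lemma cong_diff: "x \<approx> x' \<Longrightarrow> y \<approx> y' \<Longrightarrow> x - y \<approx> x' - y'"
  unfolding cong_def using two_sided_ideal_diff[OF J_ideal, of "x - x'" "y - y'"]
  by (simp add: algebra_simps)

lemma cong_mult: "x \<approx> x' \<Longrightarrow> y \<approx> y' \<Longrightarrow> x * y \<approx> x' * y'"
  unfolding cong_def
  using two_sided_ideal_add[OF J_ideal two_sided_ideal_right[OF J_ideal, of "x - x'" y]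
      two_sided_ideal_left[OF J_ideal, of "y - y'" x']]
  by (simp add: algebra_simps)

lemma cong_left: "y \<approx> y' \<Longrightarrow> x * y \<approx> x * y'"
  and cong_right: "x \<approx> x' \<Longrightarrow> x * y \<approx> x' * y"
  by (simp_all add: cong_mult)

lemma cong_sum: "(\<And>i. i \<in> A \<Longrightarrow> f i \<approx> g i) \<Longrightarrow> (\<Sum>i\<in>A. f i) \<approx> (\<Sum>i\<in>A. g i)"
  by (induction A rule: infinite_finite_induct) (auto intro: cong_add)

lemma cong_zero_iff: "x \<approx> 0 \<longleftrightarrow> x \<in> J"
  by (simp add: cong_def)

lemma cong_zero_left: "y \<approx> 0 \<Longrightarrow> x * y \<approx> 0"
  and cong_zero_right: "x \<approx> 0 \<Longrightarrow> x * y \<approx> 0"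
  using cong_left[of y 0 x] cong_right[of x 0 y] by simp_all

lemma cong_mem: "x \<approx> y \<Longrightarrow> y \<in> J \<Longrightarrow> x \<in> J"
  using cong_trans cong_zero_iff by blast

lemma outside: "g \<notin> lpa_gens E \<Longrightarrow> monomial [g] \<approx> 0"
  by (simp add: cong_zero_iff J_outside)

lemma relator: "x - y \<in> lpa_relators E \<Longrightarrow> x \<approx> y"
  using J_relators by (auto simp: cong_def)

lemma both_zero: "x \<approx> 0 \<Longrightarrow> y \<approx> 0 \<Longrightarrow> x \<approx> y"
  using cong_trans cong_sym by blast

lemma outside_vertex: "v \<notin> verts E \<Longrightarrow> vertex_el v \<approx> 0"
  and outside_edge: "e \<notin> arcs E \<Longrightarrow> edge_el e \<approx> 0"
  and outside_ghost: "e \<notin> arcs E \<Longrightarrow> ghost_el e \<approx> 0"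
  by (auto intro!: outside simp: lpa_gens_def)

lemma vertex_idem: "vertex_el v * vertex_el v \<approx> vertex_el v"
proof (cases "v \<in> verts E")
  case True
  then show ?thesis unfolding monomial_mult append.simps
    using relator_vertex[of v E v] by (intro relator) simp
next
  case False
  then have "vertex_el v \<approx> 0" by (rule outside_vertex)
  then show ?thesis by (metis both_zero cong_zero_left)
qed

lemma vertex_orth:
  assumes "v \<noteq> w" shows "vertex_el v * vertex_el w \<approx> 0"
proof (cases "v \<in> verts E \<and> w \<in> verts E")
  case True
  then show ?thesis unfolding monomial_mult append.simps
    using relator_vertex[of v E w] assms by (intro relator) simp
next
  case False
  then have "vertex_el v \<approx> 0 \<or> vertex_el w \<approx> 0" using outside_vertex by blast
  then show ?thesis by (metis cong_zero_left cong_zero_right)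
qed

lemma tail_edge: "vertex_el (tail E e) * edge_el e \<approx> edge_el e"
proof (cases "e \<in> arcs E")
  case True
  then show ?thesis unfolding monomial_mult append.simps by (intro relator relator_tail_edge)
next
  case False
  then have "edge_el e \<approx> 0" by (rule outside_edge)
  then show ?thesis by (metis both_zero cong_zero_left)
qed

lemma edge_head: "edge_el e * vertex_el (head E e) \<approx> edge_el e"
proof (cases "e \<in> arcs E")
  case True
  then show ?thesis unfolding monomial_mult append.simps by (intro relator relator_edge_head)
next
  case False
  then have "edge_el e \<approx> 0" by (rule outside_edge)
  then show ?thesis by (metis both_zero cong_zero_right)
qed

lemma head_ghost: "vertex_el (head E e) * ghost_el e \<approx> ghost_el e"
proof (cases "e \<in> arcs E")
  case True
  then show ?thesis unfolding monomial_mult append.simps by (intro relator relator_head_ghost)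
next
  case False
  then have "ghost_el e \<approx> 0" by (rule outside_ghost)
  then show ?thesis by (metis both_zero cong_zero_left)
qed

lemma ghost_tail: "ghost_el e * vertex_el (tail E e) \<approx> ghost_el e"
proof (cases "e \<in> arcs E")
  case True
  then show ?thesis unfolding monomial_mult append.simps by (intro relator relator_ghost_tail)
next
  case False
  then have "ghost_el e \<approx> 0" by (rule outside_ghost)
  then show ?thesis by (metis both_zero cong_zero_right)
qed

lemma ghost_edge_same: "e \<in> arcs E \<Longrightarrow> ghost_el e * edge_el e \<approx> vertex_el (head E e)"
  unfolding monomial_mult append.simps
  using relator_ghost_edge[of e E e] by (intro relator) simp

lemma ghost_edge_diff:
  assumes "e \<noteq> f" shows "ghost_el e * edge_el f \<approx> 0"
proof (cases "e \<in> arcs E \<and> f \<in> arcs E")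
  case True
  then show ?thesis unfolding monomial_mult append.simps
    using relator_ghost_edge[of e E f] assms by (intro relator) simp
next
  case False
  then have "ghost_el e \<approx> 0 \<or> edge_el f \<approx> 0" using outside_edge outside_ghost by blast
  then show ?thesis by (metis cong_zero_left cong_zero_right)
qed

lemma start_path:
  assumes "awalk u p w" shows "vertex_el u * path_el p w \<approx> path_el p w"
proof (cases p)
  case Nil
  with assms show ?thesis by (simp add: awalk_Nil_iff path_el_Nil vertex_idem)
next
  case (Cons e p')
  then have u: "u = tail E e" using assms by (simp add: awalk_Cons_iff)
  have "vertex_el u * path_el p w = (vertex_el (tail E e) * edge_el e) * path_el p' w"
    by (simp only: Cons u path_el_Cons mult.assoc)
  also have "\<dots> \<approx> edge_el e * path_el p' w" by (intro cong_right tail_edge)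
  finally show ?thesis by (simp only: Cons path_el_Cons)
qed

lemma other_start_path:
  assumes "awalk u p w" "v \<noteq> u" shows "vertex_el v * path_el p w \<approx> 0"
proof -
  have "vertex_el v * path_el p w \<approx> vertex_el v * vertex_el u * path_el p w"
    unfolding mult.assoc by (intro cong_left cong_sym[OF start_path[OF assms(1)]])
  also have "\<dots> \<approx> 0" by (intro cong_zero_right vertex_orth assms)
  finally show ?thesis .
qed

lemma path_end: "path_el p w * vertex_el w \<approx> path_el p w"
proof (induction p)
  case Nil
  then show ?case by (simp add: path_el_Nil vertex_idem)
next
  case (Cons e p)
  show ?case unfolding path_el_Cons mult.assoc by (intro cong_left Cons)
qed

lemma path_el_append:
  assumes "awalk w q w'"
  shows "path_el p w * path_el q w' \<approx> path_el (p @ q) w'"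
proof (induction p)
  case Nil
  then show ?case by (simp add: path_el_Nil start_path[OF assms])
next
  case (Cons e p)
  show ?case unfolding path_el_Cons append_Cons mult.assoc by (intro cong_left Cons)
qed

lemma ghost_path_same: "awalk u p w \<Longrightarrow> ghost_path_el w p * path_el p w \<approx> vertex_el w"
proof (induction p arbitrary: u)
  case Nil
  then show ?case by (simp add: path_el_Nil ghost_path_el_Nil vertex_idem)
next
  case (Cons e p)
  then have p: "awalk (head E e) p w" and e: "e \<in> arcs E" by (auto simp: awalk_Cons_iff)
  have "ghost_path_el w (e # p) * path_el (e # p) w
      = ghost_path_el w p * ((ghost_el e * edge_el e) * path_el p w)"
    by (simp only: path_el_Cons ghost_path_el_Cons mult.assoc)
  also have "\<dots> \<approx> ghost_path_el w p * (vertex_el (head E e) * path_el p w)"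
    by (intro cong_left cong_right ghost_edge_same e)
  also have "\<dots> \<approx> ghost_path_el w p * path_el p w"
    by (intro cong_left start_path p)
  also have "\<dots> \<approx> vertex_el w" by (rule Cons.IH[OF p])
  finally show ?case .
qed

text \<open>
  In \<open>\<alpha>\<^sup>* \<beta>\<close> the letters cancel in pairs from the middle, and two different edges give 0. So a nonzero
  result requires that \<open>\<alpha>\<close> is an initial segment of \<open>\<beta>\<close>; paths of length 0 can still give 0 because
  the starting points may differ.
\<close>

lemma ghost_path_mult_path:
  assumes "awalk u p w" "awalk u' q w'" "length p \<le> length q"
  shows "ghost_path_el w p * path_el q w' \<approx> 0 \<or>
    (\<exists>r. q = p @ r \<and> awalk w r w' \<and> ghost_path_el w p * path_el q w' \<approx> path_el r w')"
  using assms
proof (induction p arbitrary: u u' q)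
  case Nil
  then show ?case using other_start_path[of u' q w' w] start_path[of u' q w']
    by (cases "u' = w") (auto simp: ghost_path_el_Nil)
next
  case (Cons e p)
  then obtain f q' where q: "q = f # q'" by (cases q) auto
  with Cons.prems have p: "awalk (head E e) p w" and e: "e \<in> arcs E"
    and q': "awalk (head E f) q' w'" and len: "length p \<le> length q'"
    by (auto simp: awalk_Cons_iff)
  have split: "ghost_path_el w (e # p) * path_el q w'
      = ghost_path_el w p * ((ghost_el e * edge_el f) * path_el q' w')"
    by (simp only: path_el_Cons ghost_path_el_Cons mult.assoc q)
  show ?case
  proof (cases "e = f")
    case False
    then show ?thesis unfolding split
      by (intro disjI1 cong_zero_left cong_zero_right ghost_edge_diff)
  next
    case True
    have "ghost_path_el w (e # p) * path_el q w'
        \<approx> ghost_path_el w p * (vertex_el (head E e) * path_el q' w')"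
      unfolding split True[symmetric] by (intro cong_left cong_right ghost_edge_same e)
    also have "\<dots> \<approx> ghost_path_el w p * path_el q' w'"
      by (intro cong_left start_path) (simp add: q' True)
    finally have *: "ghost_path_el w (e # p) * path_el q w' \<approx> ghost_path_el w p * path_el q' w'" .
    from Cons.IH[OF p q' len] show ?thesis
      using cong_trans[OF *] True q by auto
  qed
qed

text \<open>
  Linear extension: what holds for words holds for their linear combinations. For \<open>Q = {}\<close> the
  conclusion is that \<open>b * x * a\<close> vanishes.
\<close>

lemma cong_supported:
  assumes words: "\<And>k. k \<in> K \<Longrightarrow> \<exists>y. Poly_Mapping.keys y \<subseteq> Q \<and> b * Poly_Mapping.single k 1 * a \<approx> y"
    and "Poly_Mapping.keys x \<subseteq> K"
  shows "\<exists>y. Poly_Mapping.keys y \<subseteq> Q \<and> b * x * a \<approx> y"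
proof (induction x rule: poly_mapping_linear_induct)
  case zero
  show ?case by (intro exI[of _ 0]) simp
next
  case (add x y)
  then obtain x' y' where "Poly_Mapping.keys x' \<subseteq> Q" "b * x * a \<approx> x'"
    "Poly_Mapping.keys y' \<subseteq> Q" "b * y * a \<approx> y'" by blast
  then show ?case unfolding distrib_left distrib_right
    by (intro exI[of _ "x' + y'"] conjI keys_add_subset cong_add)
next
  case (single k c)
  then obtain y where y: "Poly_Mapping.keys y \<subseteq> Q" "b * Poly_Mapping.single k 1 * a \<approx> y"
    using assms by blast
  have "b * Poly_Mapping.single k c * a = scalar c * (b * Poly_Mapping.single k 1 * a)"
    unfolding mult.assoc scalar_left_commute[of b c, symmetric]
    by (simp add: mult.assoc[symmetric] mult_single)
  then have "b * Poly_Mapping.single k c * a \<approx> scalar c * y"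
    using cong_left[OF y(2), of "scalar c"] by (simp only:)
  then show ?case using y(1) keys_scalar_mult[of c y] by blast
qed

end

section \<open>Combinatorics of closed paths\<close>

definition path_power :: "nat \<Rightarrow> 'e list \<Rightarrow> 'e list" where
  "path_power m c = concat (replicate m c)"

lemma path_power_Suc: "path_power (Suc m) c = c @ path_power m c"
  by (simp add: path_power_def)

lemma path_power_add: "path_power (m + n) c = path_power m c @ path_power n c"
  by (simp add: path_power_def replicate_add)

context wf_digraph
begin

lemma awalk_suffix: "awalk u (p @ q) w \<Longrightarrow> awalk u p v \<Longrightarrow> awalk v q w"
  by (auto simp: awalk_append_iff)

lemma awalk_path_power: "awalk w c w \<Longrightarrow> awalk w (path_power m c) w"
  by (induction m) (auto simp: path_power_def awalk_Nil_iff intro: awalk_appendI)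

lemma simple_closed_path_awalk: "simple_closed_path G w c \<Longrightarrow> awalk w c w \<and> c \<noteq> []"
  by (simp add: simple_closed_path_def closed_path_def)

text \<open>
  A simple closed path is back at its base only at its end.
\<close>

lemma simple_closed_path_prefix:
  assumes "simple_closed_path G w (r @ s)" and r: "awalk w r w" "r \<noteq> []"
  shows "s = []"
proof (rule ccontr)
  assume s: "s \<noteq> []"
  from assms have "awalk w s w" using awalk_suffix simple_closed_path_awalk by blast
  then have "tail G (hd s) = w" using s by (cases s) (auto simp: awalk_Cons_iff)
  moreover have "tail G (hd (r @ s)) = w" using r by (cases r) (auto simp: awalk_Cons_iff)
  moreover have "hd s \<in> set (tl (r @ s))" using r s by simp
  ultimately show False using assms(1) unfolding simple_closed_path_def by metis
qed

lemma simple_closed_paths_incomparable: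
  assumes "simple_closed_path G w c" "simple_closed_path G w d" "c @ s = d @ t"
  shows "c = d"
proof -
  from assms(3) consider us where "c = d @ us" | us where "d = c @ us"
    by (auto simp: append_eq_append_conv2)
  then show ?thesis
    using simple_closed_path_prefix simple_closed_path_awalk assms(1,2) by cases fastforce+
qed

text \<open>
  By the two preceding lemmas a closed path at \<open>w\<close> is a product of simple ones in only one way. If
  both sides were equal, then \<open>r\<close> would have to start with \<open>c\<close>, which can be cancelled. Since \<open>r\<close> has
  at most \<open>m\<close> factors, it is used up while \<open>d\<close> has not yet been reached on the right; as \<open>m \<le> m'\<close>, the
  left side still has a factor \<open>c\<close> where the right side has \<open>d\<close>.
\<close>

lemma no_shift_of_power:
  assumes c: "simple_closed_path G w c" and d: "simple_closed_path G w d" and "c \<noteq> d"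
    and "awalk w r w" "r \<noteq> []" "length r \<le> m" "m \<le> m'"
  shows "r @ path_power m' c @ d \<noteq> path_power m c @ d @ t"
  using assms(4-)
proof (induction m arbitrary: r)
  case 0
  then show ?case by simp
next
  case (Suc m)
  show ?case
  proof
    assume "r @ path_power m' c @ d = path_power (Suc m) c @ d @ t"
    then have eq: "r @ path_power m' c @ d = c @ path_power m c @ d @ t"
      by (simp add: path_power_Suc)
    obtain s where s: "r = c @ s" and eq': "s @ path_power m' c @ d = path_power m c @ d @ t"
    proof -
      from eq consider s where "r = c @ s" "s @ path_power m' c @ d = path_power m c @ d @ t"
        | s where "r @ s = c" "path_power m' c @ d = s @ path_power m c @ d @ t"
        unfolding append_eq_append_conv2[of r] by metis
      then show ?thesis
      proof cases
        case 2
        then have "s = []" using simple_closed_path_prefix[of w r s] c Suc.prems by blast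
        with 2 that[of "[]"] show ?thesis by simp
      qed (rule that)
    qed
    show False
    proof (cases "s = []")
      case True
      obtain n where "m' = m + Suc n" using Suc.prems less_iff_Suc_add[of m m'] by auto
      then have "path_power m' c = path_power m c @ c @ path_power n c"
        by (simp only: path_power_add path_power_Suc)
      then have "c @ path_power n c @ d = d @ t"
        using eq' True by simp
      then show False using simple_closed_paths_incomparable[OF c d] \<open>c \<noteq> d\<close> by blast
    next
      case False
      have "awalk w s w" using Suc.prems s awalk_suffix simple_closed_path_awalk[OF c] by blast
      moreover have "length s \<le> m" using Suc.prems s simple_closed_path_awalk[OF c] by (cases c) auto
      ultimately show False using Suc.IH[of s] False Suc.prems eq' by auto
    qed
  qed
qed

end

section \<open>Degrees\<close>

fun letter_degree :: "('v, 'e) lpa_gen \<Rightarrow> int" where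
  "letter_degree (Vertex v) = 0"
| "letter_degree (Edge e) = 1"
| "letter_degree (Ghost e) = - 1"

definition word_degree :: "('v, 'e) lpa_gen free_word \<Rightarrow> int" where
  "word_degree k = sum_list (map letter_degree (letters k))"

lemma word_degree_Word: "word_degree (Word gs) = sum_list (map letter_degree gs)"
  by (simp add: word_degree_def)

lemma word_degree_add: "word_degree (k + l) = word_degree k + word_degree l"
  by (simp add: word_degree_def plus_free_word_def)

definition homogeneous :: "int \<Rightarrow> ('v, 'e, 'k::field) lpa_free \<Rightarrow> bool" where
  "homogeneous n x \<longleftrightarrow> (\<forall>k\<in>Poly_Mapping.keys x. word_degree k = n)"

lemma sum_list_degree_edges: "sum_list (map letter_degree (map Edge p)) = int (length p)"
  by (induction p) auto

lemma sum_list_degree_ghosts: "sum_list (map letter_degree (map Ghost p)) = - int (length p)"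
  by (induction p) auto

section \<open>Reduction of elements of an ideal\<close>

context lpa_congruence
begin

definition real_words :: "'v \<Rightarrow> ('v, 'e) lpa_gen free_word set" where
  "real_words w = {Word (map Edge p @ [Vertex w]) | p u. awalk u p w}"

definition closed_words :: "'v \<Rightarrow> ('v, 'e) lpa_gen free_word set" where
  "closed_words w = {Word (map Edge r @ [Vertex w]) | r. awalk w r w \<and> r \<noteq> []}"

definition normal_words :: "nat \<Rightarrow> 'v \<Rightarrow> ('v, 'e) lpa_gen free_word set" where
  "normal_words d w = {Word (map Edge p @ Vertex v # map Ghost (rev q)) | p u v q.
     awalk u p v \<and> awalk w q v \<and> length q \<le> d}"

lemma keys_path_el: "Poly_Mapping.keys (path_el p w :: ('v, 'e, 'k) lpa_free) = {Word (map Edge p @ [Vertex w])}"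
  by (simp add: path_el_def)

text \<open>
  If \<open>\<alpha>\<close> is a shortest path in \<open>x\<close>, then \<open>\<alpha>\<^sup>*\<close> maps \<open>\<alpha>\<close> to \<open>w\<close> and any other path \<open>\<beta>\<close> in \<open>x\<close> either to
  0 or to the nonempty rest of \<open>\<beta>\<close>, which starts at the range \<open>w\<close> of \<open>\<alpha>\<close> and ends at \<open>w\<close>.
\<close>

lemma divide_by_shortest_path:
  assumes x: "Poly_Mapping.keys x \<subseteq> real_words w" and "x \<noteq> 0"
  shows "\<exists>a z. Poly_Mapping.keys z \<subseteq> closed_words w \<and> a * x \<approx> vertex_el w + z"
proof -
  define len where "len k = length (letters k)" for k :: "('v, 'e) lpa_gen free_word"
  have "Poly_Mapping.keys x \<noteq> {}" using \<open>x \<noteq> 0\<close> by simp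
  then obtain k0 where k0: "k0 \<in> Poly_Mapping.keys x"
    and min: "\<And>k. k \<in> Poly_Mapping.keys x \<Longrightarrow> len k0 \<le> len k"
    using ex_min_if_finite[OF finite_imageI[OF finite_keys[of x]], of len] by (force simp: not_less)
  then obtain p u where p: "k0 = Word (map Edge p @ [Vertex w])" "awalk u p w"
    using x by (auto simp: real_words_def)
  define c where "c = Poly_Mapping.lookup x k0"
  have c: "c \<noteq> 0" using k0 by (simp add: c_def in_keys_iff)
  define x' where "x' = part (\<lambda>k. k \<noteq> k0) x"
  have split: "x = scalar c * path_el p w + x'"
    by (rule poly_mapping_eqI)
      (auto simp: lookup_add scalar_mult_single path_el_def p(1)[symmetric] x'_def lookup_part
        lookup_single when_def c_def)
  have "\<exists>y. Poly_Mapping.keys y \<subseteq> closed_words w \<and> ghost_path_el w p * Poly_Mapping.single k 1 * 1 \<approx> y"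
    if k: "k \<in> Poly_Mapping.keys x'" for k
  proof -
    from k have kx: "k \<in> Poly_Mapping.keys x" "k \<noteq> k0" by (auto simp: x'_def keys_part)
    with x obtain q u' where q: "k = Word (map Edge q @ [Vertex w])" "awalk u' q w"
      by (auto simp: real_words_def)
    have "length p \<le> length q" using min[OF kx(1)] by (simp add: len_def p q)
    from ghost_path_mult_path[OF p(2) q(2) this] show ?thesis
    proof (elim disjE exE conjE)
      assume "ghost_path_el w p * path_el q w \<approx> 0"
      then show ?thesis by (intro exI[of _ 0]) (simp add: q path_el_def)
    next
      fix r assume r: "q = p @ r" "awalk w r w" "ghost_path_el w p * path_el q w \<approx> path_el r w"
      then have "r \<noteq> []" using kx q p by auto
      then show ?thesis using r
        by (intro exI[of _ "path_el r w"]) (auto simp: q path_el_def keys_path_el closed_words_def)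
    qed
  qed
  then have "\<exists>y. Poly_Mapping.keys y \<subseteq> closed_words w \<and> ghost_path_el w p * x' * 1 \<approx> y"
    by (rule cong_supported[OF _ order_refl])
  then obtain z where z: "Poly_Mapping.keys z \<subseteq> closed_words w" "ghost_path_el w p * x' \<approx> z"
    unfolding mult_1_right by blast
  define a where "a = scalar (inverse c) * ghost_path_el w p"
  have "ghost_path_el w p * x = scalar c * (ghost_path_el w p * path_el p w) + ghost_path_el w p * x'"
    unfolding split distrib_left scalar_left_commute[of "ghost_path_el w p" c] by (rule refl)
  then have "a * x = ghost_path_el w p * path_el p w + scalar (inverse c) * (ghost_path_el w p * x')"
    unfolding a_def mult.assoc by (simp only: distrib_left scalar_inverse[OF c])
  also have "\<dots> \<approx> vertex_el w + scalar (inverse c) * z"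
    by (intro cong_add ghost_path_same[OF p(2)] cong_left z)
  finally show ?thesis using z(1) keys_scalar_mult[of "inverse c" z] by blast
qed

text \<open>
  The witness is \<open>c\<^sup>m d\<close> for two simple closed paths \<open>c \<noteq> d\<close>, where \<open>m\<close> bounds the lengths of all the
  closed paths \<open>r\<close> in \<open>z\<close>: it is not an initial segment of any \<open>r c\<^sup>m d\<close>.
\<close>

lemma closed_paths_removable:
  assumes K: "condition_K E" and w: "w \<in> verts E" and z: "Poly_Mapping.keys z \<subseteq> closed_words w"
  shows "\<exists>g. awalk w g w \<and> ghost_path_el w g * z * path_el g w \<approx> 0"
proof (cases "z = 0")
  case True
  then show ?thesis using w by (intro exI[of _ "[]"]) (simp add: awalk_Nil_iff)
next
  case False
  then obtain k where "k \<in> Poly_Mapping.keys z" by (metis ex_in_conv keys_eq_empty)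
  with z have "\<exists>p. closed_path E w p" by (auto simp: closed_words_def closed_path_def)
  with K w obtain c d where cd: "c \<noteq> d" "simple_closed_path E w c" "simple_closed_path E w d"
    unfolding condition_K_def by blast
  define M where "M = Max ((\<lambda>k. length (letters k)) ` Poly_Mapping.keys z)"
  define g where "g = path_power M c @ d"
  have g: "awalk w g w"
    unfolding g_def using cd simple_closed_path_awalk awalk_path_power by (blast intro: awalk_appendI)
  have "\<exists>y. Poly_Mapping.keys y \<subseteq> {} \<and> ghost_path_el w g * Poly_Mapping.single k 1 * path_el g w \<approx> y"
    if k: "k \<in> Poly_Mapping.keys z" for k
  proof -
    from k z obtain r where r: "k = Word (map Edge r @ [Vertex w])" "awalk w r w" "r \<noteq> []"
      by (auto simp: closed_words_def)
    have "length (letters k) \<le> M" unfolding M_def using k by (intro Max_ge) auto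
    then have "length r \<le> M" by (simp add: r)
    then have no: "r @ g \<noteq> g @ t" for t
      using no_shift_of_power[OF cd(2,3,1) r(2,3), of M M t] by (simp add: g_def)
    have "ghost_path_el w g * Poly_Mapping.single k 1 * path_el g w
        = ghost_path_el w g * (path_el r w * path_el g w)"
      by (simp only: r(1) path_el_def mult.assoc)
    also have "\<dots> \<approx> ghost_path_el w g * path_el (r @ g) w"
      by (intro cong_left path_el_append g)
    also have "\<dots> \<approx> 0"
      using ghost_path_mult_path[OF g awalk_appendI[OF r(2) g]] no by auto
    finally show ?thesis by (intro exI[of _ 0]) simp
  qed
  then have "\<exists>y. Poly_Mapping.keys y \<subseteq> {} \<and> ghost_path_el w g * z * path_el g w \<approx> y"
    by (rule cong_supported[OF _ order_refl])
  then show ?thesis using g by auto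
qed

lemma real_path_end:
  assumes "Poly_Mapping.keys x \<subseteq> real_words w" shows "x * vertex_el w \<approx> x"
proof (induction x rule: poly_mapping_linear_induct)
  case (add x y)
  then show ?case by (simp add: algebra_simps cong_add)
next
  case (single k c)
  then obtain p where "k = Word (map Edge p @ [Vertex w])" using assms by (auto simp: real_words_def)
  then have "Poly_Mapping.single k c = scalar c * path_el p w"
    by (simp add: path_el_def scalar_mult_single)
  then show ?case by (simp only: mult.assoc cong_left path_end)
qed simp

text \<open>
  For a finite set \<open>F\<close> of edges that leave \<open>w\<close>, the products \<open>e e\<^sup>*\<close> are orthogonal idempotents below
  \<open>w\<close>, modulo the relations, and this is the complement of their sum.
\<close>

definition gap :: "'e set \<Rightarrow> 'v \<Rightarrow> ('v, 'e, 'k) lpa_free" where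
  "gap F w = vertex_el w - (\<Sum>e\<in>F. edge_el e * ghost_el e)"

context
  fixes F w assumes F: "finite F" "F \<subseteq> out_arcs E w"
begin

lemma gap_edge:
  assumes "f \<in> F" shows "gap F w * edge_el f \<approx> 0"
proof -
  have f: "f \<in> arcs E" "tail E f = w" using assms F by auto
  have "edge_el e * ghost_el e * edge_el f \<approx> (if e = f then edge_el f else 0)" for e
  proof (cases "e = f")
    case True
    then have "edge_el e * ghost_el e * edge_el f \<approx> edge_el f * vertex_el (head E f)"
      unfolding mult.assoc using f by (auto intro!: cong_left ghost_edge_same)
    also have "\<dots> \<approx> edge_el f" by (rule edge_head)
    finally show ?thesis using True by simp
  next
    case False
    then show ?thesis unfolding mult.assoc by (simp add: cong_zero_left ghost_edge_diff)
  qed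
  then have "(\<Sum>e\<in>F. edge_el e * ghost_el e * edge_el f) \<approx> (\<Sum>e\<in>F. if e = f then edge_el f else 0)"
    by (intro cong_sum)
  also have "\<dots> = edge_el f" using F assms by (simp add: sum.delta)
  finally have "vertex_el w * edge_el f - (\<Sum>e\<in>F. edge_el e * ghost_el e * edge_el f) \<approx> edge_el f - edge_el f"
    using tail_edge[of f] f by (intro cong_diff) auto
  then show ?thesis unfolding gap_def left_diff_distrib sum_distrib_right by simp
qed

lemma ghost_gap:
  assumes "f \<in> F" shows "ghost_el f * gap F w \<approx> 0"
proof -
  have f: "f \<in> arcs E" "tail E f = w" using assms F by auto
  have "ghost_el f * (edge_el e * ghost_el e) \<approx> (if e = f then ghost_el f else 0)" for e
  proof (cases "e = f")
    case True
    then have "ghost_el f * (edge_el e * ghost_el e) \<approx> vertex_el (head E f) * ghost_el f"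
      unfolding mult.assoc[symmetric] using f by (auto intro!: cong_right ghost_edge_same)
    also have "\<dots> \<approx> ghost_el f" by (rule head_ghost)
    finally show ?thesis using True by simp
  next
    case False
    then show ?thesis unfolding mult.assoc[symmetric]
      using cong_zero_right[OF ghost_edge_diff[of f e]] by simp
  qed
  then have "(\<Sum>e\<in>F. ghost_el f * (edge_el e * ghost_el e)) \<approx> (\<Sum>e\<in>F. if e = f then ghost_el f else 0)"
    by (intro cong_sum)
  also have "\<dots> = ghost_el f" using F assms by (simp add: sum.delta)
  finally have "ghost_el f * vertex_el w - (\<Sum>e\<in>F. ghost_el f * (edge_el e * ghost_el e)) \<approx> ghost_el f - ghost_el f"
    using ghost_tail[of f] f by (intro cong_diff) auto
  then show ?thesis unfolding gap_def right_diff_distrib sum_distrib_left by simp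
qed

lemma gap_end: "gap F w * vertex_el w \<approx> gap F w"
proof -
  have "edge_el e * ghost_el e * vertex_el w \<approx> edge_el e * ghost_el e" if "e \<in> F" for e
    unfolding mult.assoc using ghost_tail[of e] that F by (auto intro!: cong_left)
  then show ?thesis unfolding gap_def left_diff_distrib sum_distrib_right
    by (intro cong_diff cong_sum vertex_idem)
qed

lemma gap_idem: "gap F w * gap F w \<approx> gap F w"
proof -
  have "gap F w * (edge_el e * ghost_el e) \<approx> 0" if "e \<in> F" for e
    unfolding mult.assoc[symmetric] by (intro cong_zero_right gap_edge that)
  then have "(\<Sum>e\<in>F. gap F w * (edge_el e * ghost_el e)) \<approx> (\<Sum>e\<in>F. 0)"
    by (intro cong_sum)
  then have "gap F w * vertex_el w - (\<Sum>e\<in>F. gap F w * (edge_el e * ghost_el e)) \<approx> gap F w - (\<Sum>e\<in>F. 0)"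
    by (intro cong_diff gap_end)
  then show ?thesis
    by (subst (2) gap_def) (simp add: right_diff_distrib sum_distrib_left)
qed

lemma gap_closed_words:
  assumes z: "Poly_Mapping.keys z \<subseteq> closed_words w"
    and first: "\<And>e r. Word (map Edge (e # r) @ [Vertex w]) \<in> Poly_Mapping.keys z \<Longrightarrow> e \<in> F"
  shows "gap F w * z \<approx> 0"
proof -
  have "\<exists>y. Poly_Mapping.keys y \<subseteq> {} \<and> gap F w * Poly_Mapping.single k 1 * 1 \<approx> y"
    if k: "k \<in> Poly_Mapping.keys z" for k
  proof -
    from k z obtain r where r: "k = Word (map Edge r @ [Vertex w])" "r \<noteq> []"
      by (auto simp: closed_words_def)
    then obtain e s where s: "r = e # s" by (cases r) auto
    have "gap F w * Poly_Mapping.single k 1 * 1 = gap F w * edge_el e * path_el s w"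
      by (simp add: r s path_el_def mult.assoc monomial_mult)
    also have "\<dots> \<approx> 0" using first[of e s] k r s by (intro cong_zero_right gap_edge) simp
    finally show ?thesis by (intro exI[of _ 0]) simp
  qed
  then have "\<exists>y. Poly_Mapping.keys y \<subseteq> {} \<and> gap F w * z * 1 \<approx> y"
    by (rule cong_supported[OF _ order_refl])
  then show ?thesis by simp
qed

end

lemma homogeneous_gap: "homogeneous 0 (gap F w)"
proof -
  have "Poly_Mapping.keys (gap F w) \<subseteq> insert (Word [Vertex w]) ((\<lambda>e. Word [Edge e, Ghost e]) ` F)"
    unfolding gap_def monomial_mult
    by (rule order_trans[OF keys_diff]) (use keys_sum in fastforce)
  then show ?thesis by (force simp: homogeneous_def word_degree_Word)
qed

end

context lpa_congruence
begin

definition normal_el :: "'e list \<Rightarrow> 'v \<Rightarrow> 'e list \<Rightarrow> ('v, 'e, 'k) lpa_free" where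
  "normal_el p v q = monomial (map Edge p @ Vertex v # map Ghost (rev q))"

lemma normal_el_path: "normal_el p v q = path_el p v * monomial (map Ghost (rev q))"
  by (simp add: normal_el_def path_el_def monomial_mult)

lemma normal_el_Cons: "normal_el (e # p) v q = edge_el e * normal_el p v q"
  by (simp add: normal_el_def monomial_mult)

lemma normal_el_ghost_Cons: "normal_el p v (e # q) = normal_el p v q * ghost_el e"
  by (simp add: normal_el_def monomial_mult)

lemma normal_el_Nil: "normal_el p v [] = path_el p v"
  by (simp add: normal_el_def path_el_def)

lemma start_normal: "awalk u p v \<Longrightarrow> vertex_el u * normal_el p v q \<approx> normal_el p v q"
  unfolding normal_el_path mult.assoc[symmetric] by (intro cong_right start_path)

lemma other_start_normal: "awalk u p v \<Longrightarrow> x \<noteq> u \<Longrightarrow> vertex_el x * normal_el p v q \<approx> 0"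
  unfolding normal_el_path mult.assoc[symmetric] by (intro cong_zero_right other_start_path)

lemma normal_end: "awalk w q v \<Longrightarrow> normal_el p v q * vertex_el w \<approx> normal_el p v q"
proof (cases q)
  case Nil
  moreover assume "awalk w q v"
  ultimately show ?thesis using path_end[of p v] by (simp add: normal_el_Nil awalk_Nil_iff)
next
  case (Cons e q')
  moreover assume "awalk w q v"
  ultimately have "w = tail E e" by (simp add: awalk_Cons_iff)
  then show ?thesis unfolding Cons normal_el_ghost_Cons mult.assoc
    by (simp only: cong_left ghost_tail)
qed

text \<open>
  A letter in front of \<open>\<alpha> \<beta>\<^sup>*\<close> is absorbed, lengthens \<open>\<alpha>\<close>, shortens \<open>\<alpha>\<close>, lengthens \<open>\<beta>\<close> at its end (if
  \<open>\<alpha>\<close> has length 0), or makes the product vanish.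
\<close>

lemma letter_mult_normal:
  assumes p: "awalk u p v" and q: "awalk w q v"
  shows "monomial [g] * normal_el p v q \<approx> 0 \<or>
    (\<exists>p' q' u' v'. awalk u' p' v' \<and> awalk w q' v' \<and>
      int (length p') - int (length q') = letter_degree g + int (length p) - int (length q) \<and>
      monomial [g] * normal_el p v q \<approx> normal_el p' v' q')" (is "?zero \<or> ?normal")
proof (cases g)
  case (Vertex x)
  show ?thesis
  proof (cases "x = u")
    case True
    then have ?normal using assms start_normal[OF p, of q] Vertex
      by (intro exI[of _ p] exI[of _ q] exI[of _ u] exI[of _ v]) simp
    then show ?thesis ..
  next
    case False
    then show ?thesis using other_start_normal[OF p, of x q] Vertex by simp
  qed
next
  case (Edge e)
  consider "e \<notin> arcs E" | "e \<in> arcs E" "head E e = u" | "head E e \<noteq> u" by blast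
  then show ?thesis
  proof cases
    case 1
    then have ?zero unfolding Edge by (intro cong_zero_right outside_edge)
    then show ?thesis ..
  next
    case 2
    then have "awalk (tail E e) (e # p) v" using p by (simp add: awalk_Cons_iff)
    then have ?normal using q Edge
      by (intro exI[of _ "e # p"] exI[of _ q] exI[of _ "tail E e"] exI[of _ v])
        (simp add: normal_el_Cons)
    then show ?thesis ..
  next
    case 3
    have "edge_el e * normal_el p v q \<approx> edge_el e * vertex_el (head E e) * normal_el p v q"
      by (intro cong_right cong_sym[OF edge_head])
    also have "\<dots> \<approx> 0" unfolding mult.assoc by (intro cong_zero_left other_start_normal[OF p] 3)
    finally show ?thesis by (simp add: Edge)
  qed
next
  case (Ghost e)
  show ?thesis
  proof (cases p)
    case Nil
    then have uv: "u = v" using p by (simp add: awalk_Nil_iff)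
    consider "e \<notin> arcs E" | "e \<in> arcs E" "tail E e = v" | "tail E e \<noteq> v" by blast
    then show ?thesis
    proof cases
      case 1
      then have ?zero unfolding Ghost by (intro cong_zero_right outside_ghost)
      then show ?thesis ..
    next
      case 2
      have "ghost_el e * normal_el [] v q = ghost_el e * vertex_el v * monomial (map Ghost (rev q))"
        by (simp add: normal_el_def monomial_mult)
      also have "\<dots> \<approx> ghost_el e * monomial (map Ghost (rev q))"
        using cong_right[OF ghost_tail, of e] 2 by simp
      also have "\<dots> \<approx> vertex_el (head E e) * ghost_el e * monomial (map Ghost (rev q))"
        by (intro cong_right cong_sym[OF head_ghost])
      also have "\<dots> = normal_el [] (head E e) (q @ [e])"
        by (simp add: normal_el_def monomial_mult)
      finally have "ghost_el e * normal_el [] v q \<approx> normal_el [] (head E e) (q @ [e])" .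
      moreover have "awalk w (q @ [e]) (head E e)"
        using q 2 by (auto intro!: awalk_appendI simp: awalk_Cons_iff awalk_Nil_iff)
      moreover have "awalk (head E e) [] (head E e)"
        using 2 by (simp add: awalk_Nil_iff)
      ultimately have ?normal using Ghost Nil
        by (intro exI[of _ "[]"] exI[of _ "q @ [e]"] exI[of _ "head E e"]) simp
      then show ?thesis ..
    next
      case 3
      have "ghost_el e * normal_el [] v q \<approx> ghost_el e * vertex_el (tail E e) * normal_el [] v q"
        by (intro cong_right cong_sym[OF ghost_tail])
      also have "\<dots> \<approx> 0"
        unfolding mult.assoc using p Nil uv 3 by (intro cong_zero_left other_start_normal) auto
      finally show ?thesis by (simp add: Ghost Nil)
    qed
  next
    case (Cons f p')
    then have p': "awalk (head E f) p' v" and f: "f \<in> arcs E" using p by (auto simp: awalk_Cons_iff)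
    have eq: "ghost_el e * normal_el p v q = ghost_el e * edge_el f * normal_el p' v q"
      by (simp only: Cons normal_el_Cons mult.assoc)
    show ?thesis
    proof (cases "e = f")
      case True
      then have "ghost_el e * normal_el p v q \<approx> vertex_el (head E f) * normal_el p' v q"
        unfolding eq using f by (auto intro!: cong_right ghost_edge_same)
      also have "\<dots> \<approx> normal_el p' v q" by (rule start_normal[OF p'])
      finally have ?normal using p' q Ghost Cons
        by (intro exI[of _ p'] exI[of _ q] exI[of _ "head E f"] exI[of _ v]) simp
      then show ?thesis ..
    next
      case False
      then have ?zero unfolding Ghost eq by (intro cong_zero_right ghost_edge_diff)
      then show ?thesis ..
    qed
  qed
qed

lemma word_normal_form:
  "monomial gs * vertex_el w \<approx> 0 \<or>
    (\<exists>p q u v. awalk u p v \<and> awalk w q v \<and>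
      int (length p) - int (length q) = word_degree (Word gs) \<and>
      monomial gs * vertex_el w \<approx> normal_el p v q)"
proof (induction gs)
  case Nil
  show ?case
  proof (cases "w \<in> verts E")
    case True
    then show ?thesis
      by (intro disjI2 exI[of _ "[]"] exI[of _ w])
        (simp add: awalk_Nil_iff word_degree_Word normal_el_def monomial_mult)
  next
    case False
    then show ?thesis by (intro disjI1 cong_zero_left outside_vertex)
  qed
next
  case (Cons g gs)
  have eq: "monomial (g # gs) * vertex_el w = monomial [g] * (monomial gs * vertex_el w)"
    by (simp add: monomial_mult)
  from Cons.IH show ?case
  proof (elim disjE exE conjE)
    assume "monomial gs * vertex_el w \<approx> 0"
    then show ?thesis unfolding eq using cong_zero_left by blast
  next
    fix p q u v
    assume p: "awalk u p v" and q: "awalk w q v"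
      and deg: "int (length p) - int (length q) = word_degree (Word gs)"
      and "monomial gs * vertex_el w \<approx> normal_el p v q"
    then have *: "monomial (g # gs) * vertex_el w \<approx> monomial [g] * normal_el p v q"
      unfolding eq by (intro cong_left)
    have "word_degree (Word (g # gs)) = letter_degree g + int (length p) - int (length q)"
      using deg by (simp add: word_degree_Word)
    then show ?thesis
      using letter_mult_normal[OF p q, of g] cong_trans[OF *] by metis
  qed
qed

lemma keys_normal_el:
  "awalk u p v \<Longrightarrow> awalk w q v \<Longrightarrow> length q \<le> d \<Longrightarrow> Poly_Mapping.keys (normal_el p v q) \<subseteq> normal_words d w"
  unfolding normal_el_def normal_words_def by (simp only: keys_single one_neq_zero if_False) blast

lemma normal_words_mono: "d \<le> d' \<Longrightarrow> normal_words d w \<subseteq> normal_words d' w"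
  unfolding normal_words_def using le_trans by blast

lemma normal_words_0: "normal_words 0 w = real_words w"
  by (force simp: normal_words_def real_words_def awalk_Nil_iff dest: awalk_last_in_verts)

lemma normal_words_end:
  assumes "Poly_Mapping.keys x \<subseteq> normal_words d w" shows "x * vertex_el w \<approx> x"
proof (induction x rule: poly_mapping_linear_induct)
  case (add x y)
  then show ?case unfolding distrib_right by (rule cong_add)
next
  case (single k c)
  then obtain p u v q where "k = Word (map Edge p @ Vertex v # map Ghost (rev q))" and q: "awalk w q v"
    using assms by (auto simp: normal_words_def)
  then have "Poly_Mapping.single k c = scalar c * normal_el p v q"
    by (simp add: normal_el_def scalar_mult_single)
  then show ?case by (simp only: mult.assoc cong_left normal_end[OF q])
qed simp

lemma mult_vertex_normal:
  "\<exists>y d. Poly_Mapping.keys y \<subseteq> normal_words d w \<and> x * vertex_el w \<approx> y"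
proof (induction x rule: poly_mapping_linear_induct)
  case zero
  show ?case by (intro exI[of _ 0]) simp
next
  case (add x y)
  then obtain x' d y' d' where *: "Poly_Mapping.keys x' \<subseteq> normal_words d w" "x * vertex_el w \<approx> x'"
    "Poly_Mapping.keys y' \<subseteq> normal_words d' w" "y * vertex_el w \<approx> y'" by blast
  moreover have "normal_words d w \<subseteq> normal_words (max d d') w" "normal_words d' w \<subseteq> normal_words (max d d') w"
    by (simp_all add: normal_words_mono)
  ultimately show ?case unfolding distrib_right
    by (intro exI[of _ "x' + y'"] exI[of _ "max d d'"] conjI keys_add_subset cong_add) blast+
next
  case (single k c)
  have eq: "Poly_Mapping.single k c * vertex_el w = scalar c * (monomial (letters k) * vertex_el w)"
    by (subst single_eq_scalar_monomial) (rule mult.assoc)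
  from word_normal_form[of "letters k" w] show ?case
  proof (elim disjE exE conjE)
    assume "monomial (letters k) * vertex_el w \<approx> 0"
    then have "scalar c * (monomial (letters k) * vertex_el w) \<approx> 0" by (rule cong_zero_left)
    then show ?thesis unfolding eq by (intro exI[of _ 0]) simp
  next
    fix p q u v
    assume pq: "awalk u p v" "awalk w q v" and c: "monomial (letters k) * vertex_el w \<approx> normal_el p v q"
    have "Poly_Mapping.keys (scalar c * normal_el p v q) \<subseteq> Poly_Mapping.keys (normal_el p v q)"
      by (rule keys_scalar_mult)
    also have "\<dots> \<subseteq> normal_words (length q) w"
      using pq by (auto simp: normal_el_def normal_words_def)
    finally show ?thesis unfolding eq using cong_left[OF c, of "scalar c"] by blast
  qed
qed

text \<open>
  The edge \<open>f\<close> cancels the first edge of \<open>\<beta>\<close> in \<open>\<alpha> \<beta>\<^sup>*\<close>; this is what makes the induction on the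
  length of \<open>\<beta>\<close> work.
\<close>

lemma normal_mult_edge:
  assumes x: "Poly_Mapping.keys x \<subseteq> normal_words (Suc d) w" and f: "f \<in> out_arcs E w"
  shows "\<exists>y. Poly_Mapping.keys y \<subseteq> normal_words d (head E f) \<and> x * edge_el f \<approx> y"
proof -
  from f have f': "f \<in> arcs E" "tail E f = w" by auto
  have "\<exists>y. Poly_Mapping.keys y \<subseteq> normal_words d (head E f) \<and> 1 * Poly_Mapping.single k 1 * edge_el f \<approx> y"
    if k: "k \<in> normal_words (Suc d) w" for k
  proof -
    from k obtain p u v q where k: "k = Word (map Edge p @ Vertex v # map Ghost (rev q))"
      and p: "awalk u p v" and q: "awalk w q v" and len: "length q \<le> Suc d"
      by (auto simp: normal_words_def)
    have eq: "1 * Poly_Mapping.single k 1 * edge_el f = normal_el p v q * edge_el f"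
      by (simp only: k normal_el_def mult_1_left)
    show ?thesis
    proof (cases q)
      case Nil
      then have v: "v = w" using q by (simp add: awalk_Nil_iff)
      have "normal_el p v q * edge_el f = monomial (map Edge p) * (vertex_el (tail E f) * edge_el f)"
        by (simp add: normal_el_def Nil v f' monomial_mult)
      also have "\<dots> \<approx> monomial (map Edge p) * (edge_el f * vertex_el (head E f))"
        by (intro cong_left cong_trans[OF tail_edge cong_sym[OF edge_head]])
      also have "\<dots> = normal_el (p @ [f]) (head E f) []"
        by (simp add: normal_el_def monomial_mult)
      finally have "normal_el p v q * edge_el f \<approx> normal_el (p @ [f]) (head E f) []" .
      moreover have "awalk u (p @ [f]) (head E f)"
        using p f' v by (auto intro!: awalk_appendI simp: awalk_Cons_iff awalk_Nil_iff)
      then have "Poly_Mapping.keys (normal_el (p @ [f]) (head E f) []) \<subseteq> normal_words d (head E f)"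
        by (rule keys_normal_el) (use f' in \<open>simp_all add: awalk_Nil_iff\<close>)
      ultimately show ?thesis unfolding eq by blast
    next
      case (Cons e q')
      then have q': "awalk (head E e) q' v" "e \<in> arcs E" using q by (auto simp: awalk_Cons_iff)
      have eq': "normal_el p v q * edge_el f = normal_el p v q' * (ghost_el e * edge_el f)"
        by (simp only: Cons normal_el_ghost_Cons mult.assoc)
      show ?thesis
      proof (cases "e = f")
        case True
        then have "normal_el p v q * edge_el f \<approx> normal_el p v q' * vertex_el (head E f)"
          unfolding eq' using f' by (auto intro!: cong_left ghost_edge_same)
        also have "\<dots> \<approx> normal_el p v q'" using normal_end q' True by blast
        finally have "normal_el p v q * edge_el f \<approx> normal_el p v q'" .
        moreover have "Poly_Mapping.keys (normal_el p v q') \<subseteq> normal_words d (head E f)"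
          using p q' True len Cons by (intro keys_normal_el) simp_all
        ultimately show ?thesis unfolding eq by blast
      next
        case False
        then have "normal_el p v q * edge_el f \<approx> 0"
          unfolding eq' by (intro cong_zero_left ghost_edge_diff)
        then show ?thesis unfolding eq by (intro exI[of _ 0]) simp
      qed
    qed
  qed
  from cong_supported[OF this x] show ?thesis by simp
qed

text \<open>
  A term \<open>\<alpha> \<beta>\<^sup>*\<close> in which \<open>\<beta>\<close> has positive length is annihilated by the idempotent as soon as \<open>F\<close>
  contains the first edge of \<open>\<beta>\<close>. The combination \<open>x0\<close> of the remaining terms does not depend on \<open>F\<close>,
  which leaves the freedom to enlarge \<open>F\<close> later.
\<close>

lemma normal_mult_gap:
  assumes "Poly_Mapping.keys x \<subseteq> normal_words d w"
  shows "\<exists>F0 x0. finite F0 \<and> F0 \<subseteq> out_arcs E w \<and> Poly_Mapping.keys x0 \<subseteq> real_words w \<and>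
    (\<forall>F. finite F \<and> F0 \<subseteq> F \<and> F \<subseteq> out_arcs E w \<longrightarrow> x * gap F w \<approx> x0 * gap F w)"
proof (induction x rule: poly_mapping_linear_induct)
  case zero
  show ?case by (intro exI[of _ "{}"] exI[of _ 0] conjI allI impI cong_refl) simp_all
next
  case (add x y)
  from add(1) obtain F0 x0 where 0: "finite F0" "F0 \<subseteq> out_arcs E w" "Poly_Mapping.keys x0 \<subseteq> real_words w"
    "\<forall>F. finite F \<and> F0 \<subseteq> F \<and> F \<subseteq> out_arcs E w \<longrightarrow> x * gap F w \<approx> x0 * gap F w"
    by blast
  from add(2) obtain F1 x1 where 1: "finite F1" "F1 \<subseteq> out_arcs E w" "Poly_Mapping.keys x1 \<subseteq> real_words w"
    "\<forall>F. finite F \<and> F1 \<subseteq> F \<and> F \<subseteq> out_arcs E w \<longrightarrow> y * gap F w \<approx> x1 * gap F w"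
    by blast
  have "(x + y) * gap F w \<approx> (x0 + x1) * gap F w"
    if "finite F" "F0 \<union> F1 \<subseteq> F" "F \<subseteq> out_arcs E w" for F
    unfolding distrib_right by (rule cong_add) (use that 0 1 in simp_all)
  moreover have "Poly_Mapping.keys (x0 + x1) \<subseteq> real_words w" using 0 1 by (intro keys_add_subset)
  moreover have "finite (F0 \<union> F1)" "F0 \<union> F1 \<subseteq> out_arcs E w" using 0 1 by simp_all
  ultimately show ?case by (intro exI[of _ "F0 \<union> F1"] exI[of _ "x0 + x1"]) simp
next
  case (single k c)
  then obtain p u v q where k: "k = Word (map Edge p @ Vertex v # map Ghost (rev q))"
    and p: "awalk u p v" and q: "awalk w q v"
    using assms by (auto simp: normal_words_def)
  show ?case
  proof (cases q)
    case Nil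
    then have "Poly_Mapping.keys (Poly_Mapping.single k c) \<subseteq> real_words w"
      using k p q by (auto simp: real_words_def awalk_Nil_iff)
    then show ?thesis
      by (intro exI[of _ "{}"] exI[of _ "Poly_Mapping.single k c"] conjI allI impI cong_refl) simp_all
  next
    case (Cons e q')
    have e: "e \<in> out_arcs E w" using q by (simp add: Cons awalk_Cons_iff)
    have "Poly_Mapping.single k c = scalar c * normal_el p v q' * ghost_el e"
      by (simp add: k Cons normal_el_def mult_single plus_free_word_def zero_free_word_def)
    then have "Poly_Mapping.single k c * gap F w \<approx> 0 * gap F w"
      if "finite F" "{e} \<subseteq> F" "F \<subseteq> out_arcs E w" for F
      using cong_zero_left[OF cong_zero_left[OF ghost_gap[of F w e]]] that by (simp only: mult.assoc) simp
    then show ?thesis using e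
      by (intro exI[of _ "{e}"] exI[of _ 0] conjI allI impI) (simp_all del: mult_zero_left)
  qed
qed

end

section \<open>Ideals whose homogeneous elements are negligible\<close>

text \<open>
  The intended \<open>J\<close> is the graded part of \<open>N\<close>; all that matters about it is that it absorbs the
  homogeneous elements of \<open>N\<close>.
\<close>

locale lpa_ideal_pair = lpa_congruence E J
  for E :: "('v, 'e) pre_digraph" and J :: "('v, 'e, 'k::field) lpa_free set" +
  fixes N :: "('v, 'e, 'k) lpa_free set"
  assumes N_ideal: "two_sided_ideal N" and J_le_N: "J \<subseteq> N"
    and homogeneous_negligible: "x \<in> N \<Longrightarrow> homogeneous n x \<Longrightarrow> x \<in> J"
begin

lemma N_cong: "x \<approx> y \<Longrightarrow> x \<in> N \<Longrightarrow> y \<in> N"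
  using two_sided_ideal_diff[OF N_ideal, of x "x - y"] J_le_N by (auto simp: cong_def)

text \<open>
  Here Condition (K) enters: it turns \<open>w + z\<close> into \<open>w\<close>, which is homogeneous and acts on \<open>x\<close> as a
  right unit.
\<close>

lemma real_negligible:
  assumes K: "condition_K E" and x: "Poly_Mapping.keys x \<subseteq> real_words w" and xN: "x \<in> N"
  shows "x \<in> J"
proof (cases "x = 0")
  case True
  then show ?thesis by (simp add: two_sided_ideal_zero[OF J_ideal])
next
  case False
  then obtain k where "k \<in> Poly_Mapping.keys x" by (metis ex_in_conv keys_eq_empty)
  then have w: "w \<in> verts E" using x by (auto simp: real_words_def dest: awalk_last_in_verts)
  from divide_by_shortest_path[OF x False] obtain a z
    where z: "Poly_Mapping.keys z \<subseteq> closed_words w" and az: "a * x \<approx> vertex_el w + z" by blast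
  from closed_paths_removable[OF K w z] obtain g
    where g: "awalk w g w" "ghost_path_el w g * z * path_el g w \<approx> 0" by blast
  have "ghost_path_el w g * (a * x) * path_el g w
      \<approx> ghost_path_el w g * (vertex_el w + z) * path_el g w"
    by (intro cong_left cong_right az)
  also have "\<dots> = ghost_path_el w g * (vertex_el w * path_el g w) + ghost_path_el w g * z * path_el g w"
    by (simp only: distrib_left distrib_right mult.assoc)
  also have "\<dots> \<approx> ghost_path_el w g * path_el g w + 0"
    by (intro cong_add g cong_left start_path)
  also have "\<dots> \<approx> vertex_el w" using ghost_path_same[OF g(1)] by simp
  finally have "vertex_el w \<in> N"
    using N_cong two_sided_ideal_left[OF N_ideal] two_sided_ideal_right[OF N_ideal] xN by blast
  then have "vertex_el w \<in> J"
    by (rule homogeneous_negligible[of _ 0]) (simp add: homogeneous_def word_degree_Word)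
  then have "x * vertex_el w \<in> J" by (rule two_sided_ideal_left[OF J_ideal])
  then show ?thesis using cong_mem[OF cong_sym[OF real_path_end[OF x]]] by blast
qed

text \<open>
  Since all \<open>x f\<close> vanish modulo \<open>J\<close>, right multiplication by the idempotent \<open>w - (\<Sum>e\<in>F. e e\<^sup>*)\<close> does
  not change \<open>x\<close>, but it removes the ghost edges from \<open>x\<close>. What is left is divided by a shortest path.
\<close>

lemma normal_negligible_step:
  assumes x: "Poly_Mapping.keys x \<subseteq> normal_words d w" and xN: "x \<in> N"
    and edges: "\<And>f. f \<in> out_arcs E w \<Longrightarrow> x * edge_el f \<in> J"
  shows "x \<in> J"
proof -
  from normal_mult_gap[OF x] obtain F0 x0 where F0: "finite F0" "F0 \<subseteq> out_arcs E w"
    and x0: "Poly_Mapping.keys x0 \<subseteq> real_words w"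
    and gap0: "\<forall>F. finite F \<and> F0 \<subseteq> F \<and> F \<subseteq> out_arcs E w \<longrightarrow> x * gap F w \<approx> x0 * gap F w"
    by blast
  have x_gap: "x \<approx> x0 * gap F w" if F: "finite F" "F0 \<subseteq> F" "F \<subseteq> out_arcs E w" for F
  proof -
    have "x * (edge_el e * ghost_el e) \<approx> 0" if "e \<in> F" for e
    proof -
      have "x * edge_el e \<approx> 0" using edges[of e] that F by (auto simp: cong_zero_iff)
      then show ?thesis unfolding mult.assoc[symmetric] by (rule cong_zero_right)
    qed
    then have "(\<Sum>e\<in>F. x * (edge_el e * ghost_el e)) \<approx> (\<Sum>e\<in>F. 0)" by (intro cong_sum)
    then have "x * vertex_el w - (\<Sum>e\<in>F. x * (edge_el e * ghost_el e)) \<approx> x - (\<Sum>e\<in>F. 0)"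
      by (intro cong_diff normal_words_end[OF x])
    then have "x * gap F w \<approx> x" by (simp add: gap_def right_diff_distrib sum_distrib_left)
    moreover have "x * gap F w \<approx> x0 * gap F w" using gap0 F by simp
    ultimately show ?thesis by (metis cong_trans cong_sym)
  qed
  show ?thesis
  proof (cases "x0 = 0")
    case True
    then show ?thesis using x_gap[OF F0(1) order_refl F0(2)] by (simp add: cong_zero_iff)
  next
    case False
    from divide_by_shortest_path[OF x0 False] obtain a z
      where z: "Poly_Mapping.keys z \<subseteq> closed_words w" and az: "a * x0 \<approx> vertex_el w + z" by blast
    \<comment> \<open>The first edges of the closed paths in \<open>z\<close> are included so that \<open>gap F w\<close> annihilates \<open>z\<close>.\<close>
    define F where "F = F0 \<union> {e. \<exists>r. Word (map Edge (e # r) @ [Vertex w]) \<in> Poly_Mapping.keys z}"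
    have "{e. \<exists>r. Word (map Edge (e # r) @ [Vertex w]) \<in> Poly_Mapping.keys z}
        \<subseteq> (\<lambda>k. THE e. hd (letters k) = Edge e) ` Poly_Mapping.keys z"
      by (force simp: image_iff intro!: bexI[rotated])
    then have "finite {e. \<exists>r. Word (map Edge (e # r) @ [Vertex w]) \<in> Poly_Mapping.keys z}"
      by (rule finite_subset) simp
    then have fin: "finite F" using F0(1) unfolding F_def by blast
    have out: "F \<subseteq> out_arcs E w"
      using F0 z by (force simp: F_def closed_words_def awalk_Cons_iff map_eq_Cons_conv append_eq_append_conv2)
    define g where "g = gap F w"
    note g_simps = gap_idem[OF fin out, folded g_def] gap_end[OF fin out, folded g_def]
    have gz: "g * z \<approx> 0" unfolding g_def
      by (rule gap_closed_words[OF fin out z]) (auto simp: F_def)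
    have xg: "x \<approx> x0 * g" unfolding g_def by (rule x_gap[OF fin _ out]) (simp add: F_def)
    have "g * (a * x) \<approx> g * (a * (x0 * g))" by (intro cong_left xg)
    also have "\<dots> = g * (a * x0) * g" by (simp only: mult.assoc)
    also have "\<dots> \<approx> g * (vertex_el w + z) * g" by (intro cong_left cong_right az)
    also have "\<dots> = g * vertex_el w * g + g * z * g" by (simp only: distrib_left distrib_right)
    also have "\<dots> \<approx> g * g + 0" by (intro cong_add cong_right g_simps cong_zero_right gz)
    also have "\<dots> \<approx> g" using g_simps by simp
    finally have "g \<in> N" using N_cong two_sided_ideal_left[OF N_ideal] xN by blast
    then have "g \<in> J" using homogeneous_negligible homogeneous_gap unfolding g_def by blast
    then have "x0 * g \<in> J" by (rule two_sided_ideal_left[OF J_ideal])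
    then show ?thesis using cong_mem[OF xg] by blast
  qed
qed

lemma normal_negligible:
  assumes K: "condition_K E"
  shows "Poly_Mapping.keys x \<subseteq> normal_words d w \<Longrightarrow> x \<in> N \<Longrightarrow> x \<in> J"
proof (induction d arbitrary: x w)
  case 0
  then show ?case using real_negligible[OF K] by (simp add: normal_words_0)
next
  case (Suc d)
  show ?case
  proof (rule normal_negligible_step[OF Suc.prems])
    fix f assume f: "f \<in> out_arcs E w"
    from normal_mult_edge[OF Suc.prems(1) f] obtain y
      where y: "Poly_Mapping.keys y \<subseteq> normal_words d (head E f)" "x * edge_el f \<approx> y" by blast
    have "y \<in> N" using N_cong[OF y(2)] two_sided_ideal_right[OF N_ideal Suc.prems(2)] by blast
    then have "y \<in> J" using Suc.IH y(1) by blast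
    then show "x * edge_el f \<in> J" using cong_mem y(2) by blast
  qed
qed

lemma mult_vertex_negligible:
  assumes "condition_K E" "x \<in> N" shows "x * vertex_el w \<in> J"
proof -
  from mult_vertex_normal[of w x] obtain y d
    where y: "Poly_Mapping.keys y \<subseteq> normal_words d w" "x * vertex_el w \<approx> y" by blast
  have "y \<in> N" using N_cong[OF y(2)] two_sided_ideal_right[OF N_ideal assms(2)] by blast
  then show ?thesis using normal_negligible[OF assms(1) y(1)] cong_mem y(2) by blast
qed

end

section \<open>Ideals of the free algebra\<close>

lemma carrier_free_algebra:
  "carrier (free_algebra X) = {p. \<forall>w\<in>Poly_Mapping.keys p. letters w \<noteq> [] \<and> set (letters w) \<subseteq> X}"
  and zero_free_algebra: "\<zero>\<^bsub>free_algebra X\<^esub> = 0"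
  and add_free_algebra: "x \<oplus>\<^bsub>free_algebra X\<^esub> y = x + y"
  and mult_free_algebra: "x \<otimes>\<^bsub>free_algebra X\<^esub> y = x * y"
  and smult_free_algebra: "c \<odot>\<^bsub>free_algebra X\<^esub> x = scalar c * x"
  using mult_map_scale_conv_mult[of c x] by (simp_all add: free_algebra_def)

lemmas free_algebra_simps = zero_free_algebra add_free_algebra mult_free_algebra smult_free_algebra

lemma free_algebra_single:
  "Poly_Mapping.single k c \<in> carrier (free_algebra X) \<longleftrightarrow> c = 0 \<or> letters k \<noteq> [] \<and> set (letters k) \<subseteq> X"
  by (auto simp: carrier_free_algebra)

lemma free_algebra_zero: "0 \<in> carrier (free_algebra X)"
  by (simp add: carrier_free_algebra)

lemma free_algebra_add:
  assumes "x \<in> carrier (free_algebra X)" "y \<in> carrier (free_algebra X)"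
  shows "x + y \<in> carrier (free_algebra X)"
  using assms keys_add[of x y] by (auto simp: carrier_free_algebra)

lemma free_algebra_uminus: "x \<in> carrier (free_algebra X) \<Longrightarrow> - x \<in> carrier (free_algebra X)"
  by (simp add: carrier_free_algebra)

lemma free_algebra_diff:
  "x \<in> carrier (free_algebra X) \<Longrightarrow> y \<in> carrier (free_algebra X) \<Longrightarrow> x - y \<in> carrier (free_algebra X)"
  using free_algebra_add[of x X "- y"] free_algebra_uminus[of y X] by simp

lemma free_algebra_sum:
  "(\<And>i. i \<in> A \<Longrightarrow> f i \<in> carrier (free_algebra X)) \<Longrightarrow> (\<Sum>i\<in>A. f i) \<in> carrier (free_algebra X)"
  by (induction A rule: infinite_finite_induct) (auto intro: free_algebra_add free_algebra_zero)

lemma free_algebra_scalar: "x \<in> carrier (free_algebra X) \<Longrightarrow> scalar c * x \<in> carrier (free_algebra X)"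
  using keys_scalar_mult[of c x] by (auto simp: carrier_free_algebra)

lemma free_algebra_mult:
  assumes "x \<in> carrier (free_algebra X)" "y \<in> carrier (free_algebra X)"
  shows "x * y \<in> carrier (free_algebra X)"
  using assms keys_mult[of x y] by (fastforce simp: carrier_free_algebra plus_free_word_def)

lemma free_algebra_part: "x \<in> carrier (free_algebra X) \<Longrightarrow> part P x \<in> carrier (free_algebra X)"
  by (simp add: carrier_free_algebra keys_part)

lemma algebra_ideal_free_algebra:
  "algebra_ideal (free_algebra X) N \<longleftrightarrow> N \<subseteq> carrier (free_algebra X) \<and> 0 \<in> N \<and>
    (\<forall>x\<in>N. \<forall>y\<in>N. x + y \<in> N) \<and> (\<forall>c. \<forall>x\<in>N. scalar c * x \<in> N) \<and>
    (\<forall>a\<in>carrier (free_algebra X). \<forall>x\<in>N. a * x \<in> N \<and> x * a \<in> N)"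
  unfolding algebra_ideal_def linear_subspace_def free_algebra_simps by blast

text \<open>
  Words with a letter outside \<open>X\<close> count as 0. The empty word is kept, so that constant polynomials act
  as scalars.
\<close>

definition extend_ideal :: "'g set \<Rightarrow> ('g free_word \<Rightarrow>\<^sub>0 'k::field) set \<Rightarrow> ('g free_word \<Rightarrow>\<^sub>0 'k) set" where
  "extend_ideal X N = {x. part (\<lambda>k. set (letters k) \<subseteq> X) x \<in> N}"

lemma extend_ideal_iff: "x \<in> carrier (free_algebra X) \<Longrightarrow> x \<in> extend_ideal X N \<longleftrightarrow> x \<in> N"
  by (simp add: extend_ideal_def carrier_free_algebra part_eq_self)

lemma two_sided_extend_ideal:
  assumes N: "algebra_ideal (free_algebra X) N"
  shows "two_sided_ideal (extend_ideal X N)"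
proof -
  let ?P = "\<lambda>k. set (letters k) \<subseteq> X"
  note N = N[unfolded algebra_ideal_free_algebra]
  have single: "Poly_Mapping.single k c * y \<in> N \<and> y * Poly_Mapping.single k c \<in> N"
    if "y \<in> N" "?P k" for y k and c :: 'b
  proof (cases "letters k = []")
    case True
    then have "k = 0" by (cases k) (simp add: zero_free_word_def)
    then show ?thesis using N that scalar_central[of y c] by simp
  next
    case False
    then show ?thesis using N that free_algebra_single[of k c X] by blast
  qed
  show ?thesis
  proof (rule two_sided_idealI)
    fix x and k and c :: 'b assume x: "x \<in> extend_ideal X N"
    have "part ?P (Poly_Mapping.single k c * x) = (if ?P k then Poly_Mapping.single k c * part ?P x else 0)"
      using part_single_mult[of ?P k ?P c x] part_single_mult[of ?P k "\<lambda>_. False" c x]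
      by (auto simp: plus_free_word_def part_eq_0[of x "\<lambda>_. False"])
    then show "Poly_Mapping.single k c * x \<in> extend_ideal X N"
      using x N single by (simp add: extend_ideal_def)
    have "part ?P (x * Poly_Mapping.single k c) = (if ?P k then part ?P x * Poly_Mapping.single k c else 0)"
      using part_mult_single[of ?P k ?P x c] part_mult_single[of ?P k "\<lambda>_. False" x c]
      by (auto simp: plus_free_word_def part_eq_0[of x "\<lambda>_. False"])
    then show "x * Poly_Mapping.single k c \<in> extend_ideal X N"
      using x N single by (simp add: extend_ideal_def)
  qed (use N in \<open>simp_all add: extend_ideal_def\<close>)
qed

lemma two_sided_ideal_Int_carrier:
  assumes "two_sided_ideal J"
  shows "algebra_ideal (free_algebra X) (J \<inter> carrier (free_algebra X))"
  using assms unfolding algebra_ideal_free_algebra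
  by (auto simp: free_algebra_zero free_algebra_add free_algebra_scalar free_algebra_mult two_sided_ideal_def)

lemma lpa_relators_homogeneous:
  fixes r :: "('v, 'e, 'k::field) lpa_free"
  assumes "r \<in> lpa_relators E" shows "\<exists>n. homogeneous n r"
proof -
  have hom_diff: "homogeneous n (x - y)" if "homogeneous n x" "homogeneous n y"
    for n and x y :: "('v, 'e, 'k) lpa_free"
    using that keys_diff[of x y] by (auto simp: homogeneous_def)
  have hom_monomial: "homogeneous (sum_list (map letter_degree gs)) (monomial gs :: ('v, 'e, 'k) lpa_free)" for gs
    by (simp add: homogeneous_def word_degree_Word)
  have hom_0: "homogeneous n (0 :: ('v, 'e, 'k) lpa_free)" for n by (simp add: homogeneous_def)
  have hom_sum: "homogeneous n (\<Sum>i\<in>A. f i)" if "\<And>i. i \<in> A \<Longrightarrow> homogeneous n (f i)"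
    for n A and f :: "'e \<Rightarrow> ('v, 'e, 'k) lpa_free"
    using that keys_sum[of f A] by (fastforce simp: homogeneous_def)
  have "homogeneous 0 r \<or> homogeneous 1 r \<or> homogeneous (- 1) r"
    using assms unfolding lpa_relators_def
  proof (elim UnE CollectE exE conjE)
    fix v w assume "r = monomial [Vertex v, Vertex w] - (if v = w then monomial [Vertex v] else 0)"
    then have "homogeneous 0 r"
      using hom_diff[of 0 "monomial [Vertex v, Vertex w]" "if v = w then monomial [Vertex v] else 0"]
        hom_monomial[of "[Vertex v, Vertex w]"] hom_monomial[of "[Vertex v]"] hom_0
      by (cases "v = w") simp_all
    then show ?thesis by blast
  next
    fix e assume "r = monomial [Vertex (tail E e), Edge e] - monomial [Edge e]"
    then have "homogeneous 1 r"
      using hom_diff[OF hom_monomial[of "[Vertex (tail E e), Edge e]"]] hom_monomial[of "[Edge e]"] by simp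
    then show ?thesis by blast
  next
    fix e assume "r = monomial [Edge e, Vertex (head E e)] - monomial [Edge e]"
    then have "homogeneous 1 r"
      using hom_diff[OF hom_monomial[of "[Edge e, Vertex (head E e)]"]] hom_monomial[of "[Edge e]"] by simp
    then show ?thesis by blast
  next
    fix e assume "r = monomial [Vertex (head E e), Ghost e] - monomial [Ghost e]"
    then have "homogeneous (- 1) r"
      using hom_diff[OF hom_monomial[of "[Vertex (head E e), Ghost e]"]] hom_monomial[of "[Ghost e]"] by simp
    then show ?thesis by blast
  next
    fix e assume "r = monomial [Ghost e, Vertex (tail E e)] - monomial [Ghost e]"
    then have "homogeneous (- 1) r"
      using hom_diff[OF hom_monomial[of "[Ghost e, Vertex (tail E e)]"]] hom_monomial[of "[Ghost e]"] by simp
    then show ?thesis by blast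
  next
    fix e f assume "r = monomial [Ghost e, Edge f] - (if e = f then monomial [Vertex (head E e)] else 0)"
    then have "homogeneous 0 r"
      using hom_diff[of 0 "monomial [Ghost e, Edge f]" "if e = f then monomial [Vertex (head E e)] else 0"]
        hom_monomial[of "[Ghost e, Edge f]"] hom_monomial[of "[Vertex (head E e)]"] hom_0
      by (cases "e = f") simp_all
    then show ?thesis by blast
  next
    fix v assume r: "r = monomial [Vertex v] - (\<Sum>e\<in>out_arcs E v. monomial [Edge e, Ghost e])"
    have "homogeneous 0 (monomial [Edge e, Ghost e] :: ('v, 'e, 'k) lpa_free)" for e
      using hom_monomial[of "[Edge e, Ghost e]"] by simp
    then have "homogeneous 0 r"
      unfolding r using hom_monomial[of "[Vertex v]"] by (intro hom_diff hom_sum) simp_all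
    then show ?thesis by blast
  qed
  then show ?thesis by blast
qed

section \<open>Homogeneous components\<close>

abbreviation component :: "int \<Rightarrow> ('v, 'e, 'k::field) lpa_free \<Rightarrow> ('v, 'e, 'k) lpa_free" where
  "component n \<equiv> part (\<lambda>k. word_degree k = n)"

lemma homogeneous_component: "homogeneous n (component n x)"
  by (simp add: homogeneous_def keys_part)

lemma component_homogeneous: "homogeneous n x \<Longrightarrow> component m x = (if m = n then x else 0)"
  by (auto simp: homogeneous_def part_eq_self part_eq_0)

lemma sum_components: "(\<Sum>n\<in>word_degree ` Poly_Mapping.keys x. component n x) = x"
  by (rule poly_mapping_eqI) (auto simp: lookup_sum lookup_part sum.delta in_keys_iff)

definition graded_part :: "('v, 'e, 'k::field) lpa_free set \<Rightarrow> ('v, 'e, 'k) lpa_free set" where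
  "graded_part N = {x. \<forall>n. component n x \<in> N}"

lemma two_sided_graded_part:
  assumes N: "two_sided_ideal N" shows "two_sided_ideal (graded_part N)"
proof (rule two_sided_idealI)
  fix x k c assume x: "x \<in> graded_part N"
  have "component n (Poly_Mapping.single k c * x) = Poly_Mapping.single k c * component (n - word_degree k) x"
    "component n (x * Poly_Mapping.single k c) = component (n - word_degree k) x * Poly_Mapping.single k c" for n
    by (intro part_single_mult part_mult_single; auto simp: word_degree_add)+
  then show "Poly_Mapping.single k c * x \<in> graded_part N" "x * Poly_Mapping.single k c \<in> graded_part N"
    using x two_sided_ideal_left[OF N] two_sided_ideal_right[OF N] by (simp_all add: graded_part_def)
qed (use N in \<open>auto simp: graded_part_def two_sided_ideal_def\<close>)

lemma homogeneous_graded_part: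
  "two_sided_ideal N \<Longrightarrow> homogeneous n x \<Longrightarrow> x \<in> N \<Longrightarrow> x \<in> graded_part N"
  by (auto simp: graded_part_def component_homogeneous two_sided_ideal_zero)

lemma graded_part_subset:
  assumes "two_sided_ideal N" shows "graded_part N \<subseteq> N"
proof
  fix x assume "x \<in> graded_part N"
  then have "(\<Sum>n\<in>word_degree ` Poly_Mapping.keys x. component n x) \<in> N"
    by (intro two_sided_ideal_sum[OF assms]) (simp add: graded_part_def)
  then show "x \<in> N" by (simp only: sum_components)
qed

lemma lpa_congruence_graded_part:
  assumes "lpa_congruence E N" shows "lpa_congruence E (graded_part N)"
proof -
  interpret lpa_congruence E N by (rule assms)
  show ?thesis
  proof
    show "two_sided_ideal (graded_part N)" by (rule two_sided_graded_part[OF J_ideal])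
    show "lpa_relators E \<subseteq> graded_part N"
      using lpa_relators_homogeneous homogeneous_graded_part[OF J_ideal] J_relators by blast
    show "monomial [g] \<in> graded_part N" if "g \<notin> lpa_gens E" for g
      using J_outside[OF that]
      by (intro homogeneous_graded_part[OF J_ideal, of "letter_degree g"])
        (simp_all add: homogeneous_def word_degree_Word)
  qed
qed

lemma lpa_ideal_pair_graded_part:
  assumes "lpa_congruence E N" shows "lpa_ideal_pair E (graded_part N) N"
proof -
  have N: "two_sided_ideal N" using assms by (rule lpa_congruence.J_ideal)
  show ?thesis
    by (intro lpa_ideal_pair.intro lpa_ideal_pair_axioms.intro lpa_congruence_graded_part assms N
        graded_part_subset) (rule homogeneous_graded_part[OF N])
qed

fun end_vertex :: "('v, 'e) pre_digraph \<Rightarrow> ('v, 'e) lpa_gen \<Rightarrow> 'v" where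
  "end_vertex E (Vertex v) = v"
| "end_vertex E (Edge e) = head E e"
| "end_vertex E (Ghost e) = tail E e"

context lpa_congruence
begin

lemma word_mult_end_vertex:
  assumes "gs \<noteq> []" shows "monomial gs * vertex_el (end_vertex E (last gs)) \<approx> monomial gs"
proof -
  have split: "monomial gs = monomial (butlast gs) * monomial [last gs]"
    using assms by (simp add: monomial_mult)
  have "monomial [last gs] * vertex_el (end_vertex E (last gs)) \<approx> monomial [last gs]"
    by (cases "last gs") (simp_all only: end_vertex.simps vertex_idem edge_head ghost_tail)
  then show ?thesis unfolding split mult.assoc by (rule cong_left)
qed

lemma word_mult_other_vertex:
  assumes "gs \<noteq> []" "w \<noteq> end_vertex E (last gs)" shows "monomial gs * vertex_el w \<approx> 0"
proof -
  have "monomial gs * vertex_el w \<approx> monomial gs * vertex_el (end_vertex E (last gs)) * vertex_el w"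
    by (intro cong_right cong_sym[OF word_mult_end_vertex] assms)
  also have "\<dots> \<approx> 0"
    unfolding mult.assoc using assms by (intro cong_zero_left[OF vertex_orth]) simp
  finally show ?thesis .
qed

text \<open>
  The algebra may have infinitely many vertices and hence no unit, but on a given element the sum of
  finitely many vertices acts as a right unit.
\<close>

lemma local_units:
  assumes x: "x \<in> carrier (lpa_free_algebra E)"
  shows "\<exists>W. finite W \<and> (\<forall>W'. finite W' \<longrightarrow> W \<subseteq> W' \<longrightarrow> (\<Sum>w\<in>W'. x * vertex_el w) \<approx> x)"
proof (induction x rule: poly_mapping_linear_induct)
  case zero
  show ?case by (intro exI[of _ "{}"]) simp
next
  case (add x y)
  then obtain W1 W2 where W: "finite W1" "finite W2"
    "\<forall>W'. finite W' \<longrightarrow> W1 \<subseteq> W' \<longrightarrow> (\<Sum>w\<in>W'. x * vertex_el w) \<approx> x"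
    "\<forall>W'. finite W' \<longrightarrow> W2 \<subseteq> W' \<longrightarrow> (\<Sum>w\<in>W'. y * vertex_el w) \<approx> y" by auto
  have "(\<Sum>w\<in>W'. (x + y) * vertex_el w) \<approx> x + y" if "finite W'" "W1 \<union> W2 \<subseteq> W'" for W'
    unfolding distrib_right sum.distrib using W that by (intro cong_add) simp_all
  then show ?case using W by (intro exI[of _ "W1 \<union> W2"]) simp
next
  case (single k c)
  define gs where "gs = letters k"
  define v where "v = end_vertex E (last gs)"
  have gs: "gs \<noteq> []" using x single by (auto simp: gs_def carrier_free_algebra)
  have eq: "Poly_Mapping.single k c = scalar c * monomial gs"
    by (simp add: gs_def scalar_mult_single)
  have "(\<Sum>w\<in>W'. scalar c * monomial gs * vertex_el w) \<approx> scalar c * monomial gs"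
    if W': "finite W'" "v \<in> W'" for W'
  proof -
    have "scalar c * monomial gs * vertex_el w \<approx> (if w = v then scalar c * monomial gs else 0)" for w
    proof (cases "w = v")
      case True
      then show ?thesis
        using cong_left[OF word_mult_end_vertex[OF gs], of "scalar c"] by (simp add: v_def mult.assoc)
    next
      case False
      then show ?thesis
        using cong_zero_left[OF word_mult_other_vertex[OF gs, of w], of "scalar c"]
        by (simp add: v_def mult.assoc)
    qed
    then have "(\<Sum>w\<in>W'. scalar c * monomial gs * vertex_el w)
        \<approx> (\<Sum>w\<in>W'. if w = v then scalar c * monomial gs else 0)" by (intro cong_sum)
    also have "\<dots> = scalar c * monomial gs" using W' by (simp add: sum.delta)
    finally show ?thesis .
  qed
  then show ?case unfolding eq by (intro exI[of _ "{v}"]) simp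
qed

end

lemma condition_K_component_closed:
  assumes "lpa_congruence E N" and K: "condition_K E"
    and x: "x \<in> N" "x \<in> carrier (lpa_free_algebra E)"
  shows "component n x \<in> N"
proof -
  interpret lpa_ideal_pair E "graded_part N" N
    by (rule lpa_ideal_pair_graded_part[OF assms(1)])
  from local_units[OF x(2)] obtain W where "cong (\<Sum>w\<in>W. x * vertex_el w) x" by blast
  moreover have "(\<Sum>w\<in>W. x * vertex_el w) \<in> graded_part N"
    by (intro two_sided_ideal_sum[OF J_ideal] mult_vertex_negligible[OF K x(1)])
  ultimately have "x \<in> graded_part N" using cong_mem cong_sym by blast
  then show ?thesis by (simp add: graded_part_def)
qed

section \<open>The Leavitt path algebra as a quotient\<close>

lemma monomial_in_free: "gs \<noteq> [] \<Longrightarrow> set gs \<subseteq> X \<Longrightarrow> monomial gs \<in> carrier (free_algebra X)"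
  by (simp add: free_algebra_single)

lemma algebra_ideal_Inter:
  assumes ideals: "\<And>N. N \<in> \<N> \<Longrightarrow> algebra_ideal A N" and "\<N> \<noteq> {}"
  shows "algebra_ideal A (\<Inter>\<N>)"
proof -
  have N: "N \<subseteq> carrier A" "\<zero>\<^bsub>A\<^esub> \<in> N" "\<And>x y. x \<in> N \<Longrightarrow> y \<in> N \<Longrightarrow> x \<oplus>\<^bsub>A\<^esub> y \<in> N"
    "\<And>c x. x \<in> N \<Longrightarrow> c \<odot>\<^bsub>A\<^esub> x \<in> N"
    "\<And>a x. a \<in> carrier A \<Longrightarrow> x \<in> N \<Longrightarrow> a \<otimes>\<^bsub>A\<^esub> x \<in> N \<and> x \<otimes>\<^bsub>A\<^esub> a \<in> N" if "N \<in> \<N>" for N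
    using ideals[OF that] unfolding algebra_ideal_def linear_subspace_def by blast+
  show ?thesis
    unfolding algebra_ideal_def linear_subspace_def
    using N assms(2) by (intro conjI ballI allI) (fastforce | blast)+
qed

context wf_digraph
begin

lemma lpa_relators_carrier: "lpa_relators G \<subseteq> carrier (lpa_free_algebra G)"
proof -
  have v: "v \<in> verts G \<Longrightarrow> Vertex v \<in> lpa_gens G"
    and e: "e \<in> arcs G \<Longrightarrow> {Edge e, Ghost e, Vertex (tail G e), Vertex (head G e)} \<subseteq> lpa_gens G" for v e
    by (auto simp: lpa_gens_def)
  show ?thesis
    unfolding lpa_relators_def regular_vertices_def
    by (intro Un_least subsetI; elim CollectE exE conjE; hypsubst)
      (use v e in \<open>auto intro!: free_algebra_diff free_algebra_sum monomial_in_free free_algebra_zero\<close>)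
qed

lemma relation_ideal: "algebra_ideal (lpa_free_algebra G) (lpa_relation_ideal G)"
  and relators_in_relation_ideal: "lpa_relators G \<subseteq> lpa_relation_ideal G"
proof -
  have "algebra_ideal (lpa_free_algebra G) (carrier (lpa_free_algebra G))"
    unfolding algebra_ideal_free_algebra
    by (simp add: free_algebra_zero free_algebra_add free_algebra_scalar free_algebra_mult)
  then show "algebra_ideal (lpa_free_algebra G) (lpa_relation_ideal G)"
    unfolding lpa_relation_ideal_def generated_ideal_def
    using lpa_relators_carrier by (intro algebra_ideal_Inter) auto
  show "lpa_relators G \<subseteq> lpa_relation_ideal G"
    unfolding lpa_relation_ideal_def generated_ideal_def by blast
qed

lemma relation_ideal_least:
  "algebra_ideal (lpa_free_algebra G) N \<Longrightarrow> lpa_relators G \<subseteq> N \<Longrightarrow> lpa_relation_ideal G \<subseteq> N"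
  unfolding lpa_relation_ideal_def generated_ideal_def by blast

lemma lpa_congruence_extend_ideal:
  assumes N: "algebra_ideal (lpa_free_algebra G) N" and rel: "lpa_relators G \<subseteq> N"
  shows "lpa_congruence G (extend_ideal (lpa_gens G) N)"
proof
  show "two_sided_ideal (extend_ideal (lpa_gens G) N)" by (rule two_sided_extend_ideal[OF N])
  show "lpa_relators G \<subseteq> extend_ideal (lpa_gens G) N"
    using rel lpa_relators_carrier extend_ideal_iff by blast
  show "monomial [g] \<in> extend_ideal (lpa_gens G) N" if "g \<notin> lpa_gens G" for g
    using N that by (simp add: extend_ideal_def part_single algebra_ideal_free_algebra)
qed

abbreviation F :: "('k::field, ('a, 'b, 'k) lpa_free) module" where
  "F \<equiv> lpa_free_algebra G"

abbreviation R :: "('a, 'b, 'k::field) lpa_free set" where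
  "R \<equiv> lpa_relation_ideal G"

abbreviation L :: "('k::field, ('a, 'b, 'k) lpa) module" where
  "L \<equiv> leavitt_path_algebra G"

abbreviation cls :: "('a, 'b, 'k::field) lpa_free \<Rightarrow> ('a, 'b, 'k) lpa" where
  "cls \<equiv> lpa_class G"

lemmas R_ideal = relation_ideal[unfolded algebra_ideal_free_algebra]

lemma R_zero: "0 \<in> R" and R_add: "x \<in> R \<Longrightarrow> y \<in> R \<Longrightarrow> x + y \<in> R"
  and R_scalar: "x \<in> R \<Longrightarrow> scalar c * x \<in> R"
  and R_left: "a \<in> carrier F \<Longrightarrow> x \<in> R \<Longrightarrow> a * x \<in> R"
  and R_right: "a \<in> carrier F \<Longrightarrow> x \<in> R \<Longrightarrow> x * a \<in> R"
  and R_carrier: "x \<in> R \<Longrightarrow> x \<in> carrier F"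
  using R_ideal by blast+

lemma R_uminus: "x \<in> R \<Longrightarrow> - x \<in> R"
  using R_scalar[of x "- 1"] by (simp add: scalar_minus_one)

lemma R_diff: "x \<in> R \<Longrightarrow> y \<in> R \<Longrightarrow> x - y \<in> R"
  using R_add[of x "- y"] R_uminus[of y] by simp

lemma mem_cls: "y \<in> cls x \<longleftrightarrow> y - x \<in> R"
proof -
  have "cls x = {r + x | r. r \<in> R}"
    by (auto simp: lpa_class_def a_r_coset_def' add_free_algebra)
  then show ?thesis by (auto intro!: exI[of _ "y - x"])
qed

lemma cls_eq_iff: "cls x = cls y \<longleftrightarrow> x - y \<in> R"
proof
  assume "cls x = cls y"
  moreover have "x \<in> cls x" by (simp add: mem_cls R_zero)
  ultimately show "x - y \<in> R" by (simp add: mem_cls)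
next
  assume xy: "x - y \<in> R"
  show "cls x = cls y"
  proof (rule Set.set_eqI)
    fix z
    have "z - x \<in> R \<longleftrightarrow> z - y \<in> R"
      using R_add[OF _ xy, of "z - x"] R_diff[OF _ xy, of "z - y"] by auto
    then show "z \<in> cls x \<longleftrightarrow> z \<in> cls y" by (simp add: mem_cls)
  qed
qed

lemma self_in_cls: "x \<in> cls x"
  by (simp add: mem_cls R_zero)

lemma cls_carrier: "x \<in> carrier F \<Longrightarrow> y \<in> cls x \<Longrightarrow> y \<in> carrier F"
  using free_algebra_add[OF R_carrier, of "y - x" x] by (simp add: mem_cls)

lemma carrier_L: "carrier L = cls ` carrier F"
  by (auto simp: leavitt_path_algebra_def quotient_algebra_def A_RCOSETS_def' lpa_class_def)

lemma zero_L: "\<zero>\<^bsub>L\<^esub> = cls 0"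
  by (auto simp: leavitt_path_algebra_def quotient_algebra_def mem_cls)

lemma add_L: "cls x \<oplus>\<^bsub>L\<^esub> cls y = cls (x + y)"
proof -
  have "cls x \<oplus>\<^bsub>L\<^esub> cls y = {a + b | a b. a \<in> cls x \<and> b \<in> cls y}"
    by (auto simp: leavitt_path_algebra_def quotient_algebra_def set_add_defs free_algebra_def)
  also have "\<dots> = cls (x + y)"
  proof (intro equalityI subsetI)
    fix z assume "z \<in> {a + b | a b. a \<in> cls x \<and> b \<in> cls y}"
    then obtain a b where "z = a + b" "a \<in> cls x" "b \<in> cls y" by blast
    then show "z \<in> cls (x + y)"
      using R_add[of "a - x" "b - y"] by (simp add: mem_cls algebra_simps)
  next
    fix z assume "z \<in> cls (x + y)"
    then have "z - y \<in> cls x" by (simp add: mem_cls algebra_simps)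
    then show "z \<in> {a + b | a b. a \<in> cls x \<and> b \<in> cls y}"
      using self_in_cls[of y] by (force intro: exI[of _ "z - y"])
  qed
  finally show ?thesis .
qed

lemma mult_L:
  assumes "x \<in> carrier F" "y \<in> carrier F" shows "cls x \<otimes>\<^bsub>L\<^esub> cls y = cls (x * y)"
proof -
  have "cls x \<otimes>\<^bsub>L\<^esub> cls y = (\<Union>a\<in>cls x. \<Union>b\<in>cls y. cls (a * b))"
    by (simp add: leavitt_path_algebra_def quotient_algebra_def rcoset_mult_def mult_free_algebra
        lpa_class_def)
  also have "\<dots> = (\<Union>a\<in>cls x. \<Union>b\<in>cls y. cls (x * y))"
  proof (intro SUP_cong refl)
    fix a b assume ab: "a \<in> cls x" "b \<in> cls y"
    have "(a - x) * b + x * (b - y) \<in> R"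
      using ab assms cls_carrier by (intro R_add R_left R_right) (auto simp: mem_cls)
    then show "cls (a * b) = cls (x * y)" by (simp add: cls_eq_iff algebra_simps)
  qed
  also have "\<dots> = cls (x * y)" using self_in_cls by blast
  finally show ?thesis .
qed

lemma smult_L: "c \<odot>\<^bsub>L\<^esub> cls x = cls (scalar c * x)"
proof -
  have "c \<odot>\<^bsub>L\<^esub> cls x = (\<Union>a\<in>cls x. cls (scalar c * a))"
    by (simp add: leavitt_path_algebra_def quotient_algebra_def smult_free_algebra lpa_class_def)
  also have "\<dots> = (\<Union>a\<in>cls x. cls (scalar c * x))"
  proof (intro SUP_cong refl)
    fix a assume "a \<in> cls x"
    then show "cls (scalar c * a) = cls (scalar c * x)"
      using R_scalar[of "a - x" c] by (simp add: mem_cls cls_eq_iff algebra_simps)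
  qed
  also have "\<dots> = cls (scalar c * x)" using self_in_cls by blast
  finally show ?thesis .
qed

lemma abelian_monoid_L: "abelian_monoid L"
  by (rule abelian_monoidI)
    (auto simp: carrier_L zero_L add_L add_ac free_algebra_add free_algebra_zero)

lemma finsum_L:
  assumes "finite A" "\<And>i. i \<in> A \<Longrightarrow> f i \<in> carrier F"
  shows "(\<Oplus>\<^bsub>L\<^esub>i\<in>A. cls (f i)) = cls (\<Sum>i\<in>A. f i)"
proof -
  interpret L: abelian_monoid L by (rule abelian_monoid_L)
  show ?thesis using assms
    by (induction A rule: finite_induct) (simp_all add: zero_L add_L carrier_L Pi_def)
qed

section \<open>Ideals and homogeneous components of the quotient\<close>

lemma ideal_preimage:
  assumes I: "algebra_ideal L I"
  defines "N \<equiv> {x \<in> carrier F. cls x \<in> I}"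
  shows "algebra_ideal F N" "lpa_relators G \<subseteq> N" "I = cls ` N"
proof -
  have sub: "I \<subseteq> cls ` carrier F" "cls 0 \<in> I"
    and add: "\<And>x y. cls x \<in> I \<Longrightarrow> cls y \<in> I \<Longrightarrow> cls (x + y) \<in> I"
    and scal: "\<And>c x. cls x \<in> I \<Longrightarrow> cls (scalar c * x) \<in> I"
    using I unfolding algebra_ideal_def linear_subspace_def carrier_L zero_L
    by (auto simp: add_L[symmetric] smult_L[symmetric])
  have mult: "cls (a * x) \<in> I \<and> cls (x * a) \<in> I"
    if "a \<in> carrier F" "x \<in> carrier F" "cls x \<in> I" for a x
    using I that unfolding algebra_ideal_def carrier_L by (auto simp: mult_L[symmetric])
  show "algebra_ideal F N"
    unfolding algebra_ideal_free_algebra N_def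
    using sub add scal mult
    by (auto simp: free_algebra_zero free_algebra_add free_algebra_scalar free_algebra_mult)
  show "I = cls ` N" using sub by (auto simp: N_def)
  show "lpa_relators G \<subseteq> N"
  proof
    fix r :: "('a, 'b, 'c) lpa_free" assume "r \<in> lpa_relators G"
    then have r: "r \<in> R" using relators_in_relation_ideal by blast
    then have "cls r = cls 0" by (simp add: cls_eq_iff)
    then show "r \<in> N" using sub R_carrier[OF r] by (simp add: N_def)
  qed
qed

lemma ideal_image:
  assumes N: "algebra_ideal F N" and rel: "lpa_relators G \<subseteq> N"
  shows "algebra_ideal L (cls ` N)" and "x \<in> carrier F \<Longrightarrow> cls x \<in> cls ` N \<longleftrightarrow> x \<in> N"
proof -
  note NN = N[unfolded algebra_ideal_free_algebra]
  have R: "R \<subseteq> N" by (rule relation_ideal_least[OF N rel])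
  show "algebra_ideal L (cls ` N)"
    unfolding algebra_ideal_def linear_subspace_def carrier_L zero_L
  proof (intro conjI ballI allI)
    show "cls ` N \<subseteq> cls ` carrier F" "cls 0 \<in> cls ` N" using NN by auto
    show "X \<oplus>\<^bsub>L\<^esub> Y \<in> cls ` N" if "X \<in> cls ` N" "Y \<in> cls ` N" for X Y
      using that NN by (auto simp: add_L)
    show "c \<odot>\<^bsub>L\<^esub> X \<in> cls ` N" if "X \<in> cls ` N" for c X
      using that NN by (auto simp: smult_L)
    show "A \<otimes>\<^bsub>L\<^esub> X \<in> cls ` N" "X \<otimes>\<^bsub>L\<^esub> A \<in> cls ` N"
      if "A \<in> cls ` carrier F" "X \<in> cls ` N" for A X
    proof -
      from that obtain a x where "A = cls a" "a \<in> carrier F" "X = cls x" "x \<in> N" "x \<in> carrier F"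
        using NN by blast
      then show "A \<otimes>\<^bsub>L\<^esub> X \<in> cls ` N" "X \<otimes>\<^bsub>L\<^esub> A \<in> cls ` N"
        using NN by (auto simp: mult_L)
    qed
  qed
  show "cls x \<in> cls ` N \<longleftrightarrow> x \<in> N" if "x \<in> carrier F"
  proof
    assume "cls x \<in> cls ` N"
    then obtain y where y: "y \<in> N" "x - y \<in> R" by (auto simp: cls_eq_iff)
    then have "(x - y) + y \<in> N" using R NN by blast
    then show "x \<in> N" by simp
  qed simp
qed

lemma lpa_path_mult_ghost_path:
  assumes p: "awalk u p v" and q: "awalk w q v'"
  shows "lpa_path G u p \<otimes>\<^bsub>L\<^esub> lpa_ghost_path G w q
    = cls (monomial ((if p = [] then [Vertex u] else map Edge p)
        @ (if q = [] then [Vertex w] else map Ghost (rev q))))" (is "_ = cls (monomial (?p @ ?q))")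
    and "(if p = [] then [Vertex u] else map Edge p)
        @ (if q = [] then [Vertex w] else map Ghost (rev q)) \<noteq> []"
    and "set ((if p = [] then [Vertex u] else map Edge p)
        @ (if q = [] then [Vertex w] else map Ghost (rev q))) \<subseteq> lpa_gens G"
proof -
  have *: "set ?p \<subseteq> lpa_gens G" "?p \<noteq> []" "set ?q \<subseteq> lpa_gens G" "?q \<noteq> []"
    using p q by (auto simp: lpa_gens_def awalk_def)
  then show "?p @ ?q \<noteq> []" "set (?p @ ?q) \<subseteq> lpa_gens G" by auto
  show "lpa_path G u p \<otimes>\<^bsub>L\<^esub> lpa_ghost_path G w q = cls (monomial (?p @ ?q))"
    unfolding lpa_path_def lpa_ghost_path_def monomial_mult[symmetric]
    by (intro mult_L monomial_in_free *)
qed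

lemma cong_extend_R_iff:
  assumes "x \<in> carrier F" "y \<in> carrier F"
  shows "x - y \<in> extend_ideal (lpa_gens G) R \<longleftrightarrow> cls x = cls y"
  using assms by (simp add: cls_eq_iff extend_ideal_iff free_algebra_diff)

text \<open>
  The normal form of words, rewritten for paths of length 0 that are given by a vertex and not by the
  empty word.
\<close>

lemma word_eq_path_mult_ghost_path:
  fixes gs :: "('a, 'b) lpa_gen list"
  assumes gs: "gs \<noteq> []" "set gs \<subseteq> lpa_gens G"
  shows "(cls (monomial gs) :: ('a, 'b, 'k::field) lpa) = cls 0 \<or>
    (\<exists>p q u v w. awalk u p v \<and> awalk w q v \<and> int (length p) - int (length q) = word_degree (Word gs) \<and>
      (cls (monomial gs) :: ('a, 'b, 'k) lpa) = lpa_path G u p \<otimes>\<^bsub>L\<^esub> lpa_ghost_path G w q)"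
proof -
  interpret R: lpa_congruence G "extend_ideal (lpa_gens G) R :: ('a, 'b, 'k) lpa_free set"
    by (rule lpa_congruence_extend_ideal[OF relation_ideal relators_in_relation_ideal])
  have cls_eq: "R.cong x y \<longleftrightarrow> cls x = cls y" if "x \<in> carrier F" "y \<in> carrier F" for x y
    unfolding R.cong_def by (rule cong_extend_R_iff[OF that])
  have gsF: "monomial gs \<in> carrier F" by (rule monomial_in_free[OF gs])
  let ?w = "end_vertex G (last gs)"
  have *: "R.cong (monomial gs) (monomial gs * vertex_el ?w)"
    by (rule R.cong_sym[OF R.word_mult_end_vertex[OF gs(1)]])
  from R.word_normal_form[of gs ?w] show ?thesis
  proof (elim disjE exE conjE)
    assume "R.cong (monomial gs * vertex_el ?w) 0"
    then have "R.cong (monomial gs) 0" using * R.cong_trans by blast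
    then show ?thesis using cls_eq[OF gsF free_algebra_zero] by blast
  next
    fix p q u v
    assume p: "awalk u p v" and q: "awalk ?w q v"
      and deg: "int (length p) - int (length q) = word_degree (Word gs)"
      and "R.cong (monomial gs * vertex_el ?w) (R.normal_el p v q)"
    then have gs_normal: "R.cong (monomial gs) (R.normal_el p v q)" using * R.cong_trans by blast
    let ?p = "if p = [] then [Vertex u] else map Edge p"
    let ?q = "if q = [] then [Vertex ?w] else map Ghost (rev q)"
    have p_path: "R.cong (path_el p v) (monomial ?p)"
    proof (cases p rule: rev_cases)
      case Nil
      then show ?thesis using p by (simp add: path_el_def awalk_Nil_iff)
    next
      case (snoc p' e)
      then have "v = head G e" using p by (auto simp: awalk_append_iff awalk_Cons_iff awalk_Nil_iff)
      then have "path_el p v = monomial (map Edge p') * (edge_el e * vertex_el (head G e))"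
        by (simp add: snoc path_el_def monomial_mult)
      also have "R.cong \<dots> (monomial (map Edge p') * edge_el e)"
        by (intro R.cong_left R.edge_head)
      finally show ?thesis by (simp add: snoc monomial_mult)
    qed
    have q_path: "R.cong (vertex_el v * monomial (map Ghost (rev q))) (vertex_el v * monomial ?q)"
    proof (cases "q = []")
      case True
      then have "?w = v" using q by (simp add: awalk_Nil_iff)
      then show ?thesis using True R.cong_sym[OF R.vertex_idem[of v]] by (simp add: monomial_mult)
    qed simp
    have "R.normal_el p v q = monomial (map Edge p) * (vertex_el v * monomial (map Ghost (rev q)))"
      by (simp add: R.normal_el_def monomial_mult)
    also have "R.cong \<dots> (monomial (map Edge p) * (vertex_el v * monomial ?q))"
      by (intro R.cong_left q_path)
    also have "\<dots> = path_el p v * monomial ?q"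
      by (simp add: path_el_def monomial_mult)
    also have "R.cong \<dots> (monomial ?p * monomial ?q)" by (intro R.cong_right p_path)
    finally have "R.cong (monomial gs) (monomial (?p @ ?q))"
      unfolding monomial_mult by (rule R.cong_trans[OF gs_normal])
    then have "cls (monomial gs :: ('a, 'b, 'k) lpa_free) = cls (monomial (?p @ ?q))"
      using cls_eq[OF gsF monomial_in_free] lpa_path_mult_ghost_path(2,3)[OF p q] by blast
    then show ?thesis using p q deg lpa_path_mult_ghost_path(1)[OF p q] by metis
  qed
qed

text \<open>
  The span of the products \<open>\<alpha> \<beta>\<^sup>*\<close> of degree \<open>n\<close> already contains the classes of all words of degree
  \<open>n\<close>, because normal forms preserve the degree. Components can thus be computed in the free algebra.
\<close>

lemma lpa_component_eq:
  "(lpa_component G n :: ('a, 'b, 'k::field) lpa set) = cls ` {x \<in> carrier F. homogeneous n x}"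
proof
  have hom_add: "homogeneous n (x + y)" if "homogeneous n x" "homogeneous n y"
    for x y :: "('a, 'b, 'k) lpa_free"
    using that keys_add[of x y] by (auto simp: homogeneous_def)
  have hom_scalar: "homogeneous n (scalar c * x)" if "homogeneous n x"
    for c and x :: "('a, 'b, 'k) lpa_free"
    using that keys_scalar_mult[of c x] by (auto simp: homogeneous_def)
  show "(lpa_component G n :: ('a, 'b, 'k) lpa set) \<subseteq> cls ` {x \<in> carrier F. homogeneous n x}"
    unfolding lpa_component_def linear_span_def
  proof (intro Inter_lower CollectI conjI)
    show "linear_subspace (L :: ('k, ('a, 'b, 'k) lpa) module) (cls ` {x \<in> carrier F. homogeneous n x})"
      unfolding linear_subspace_def carrier_L zero_L
    proof (intro conjI ballI allI)
      show "cls (0 :: ('a, 'b, 'k) lpa_free) \<in> cls ` {x \<in> carrier F. homogeneous n x}"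
        by (intro imageI) (simp add: free_algebra_zero homogeneous_def)
    qed (auto simp: add_L smult_L hom_add hom_scalar free_algebra_add free_algebra_scalar intro!: imageI)
    show "{lpa_path G u p \<otimes>\<^bsub>L\<^esub> lpa_ghost_path G u' q :: ('a, 'b, 'k) lpa | u p v u' q v'.
        awalk u p v \<and> awalk u' q v' \<and> int (length p) - int (length q) = n}
      \<subseteq> cls ` {x \<in> carrier F. homogeneous n x}"
    proof (intro subsetI; elim CollectE exE conjE)
      fix X :: "('a, 'b, 'k) lpa" and u p v u' q v'
      assume X: "X = lpa_path G u p \<otimes>\<^bsub>L\<^esub> lpa_ghost_path G u' q"
        and p: "awalk u p v" and q: "awalk u' q v'" and deg: "int (length p) - int (length q) = n"
      show "X \<in> cls ` {x \<in> carrier F. homogeneous n x}"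
        unfolding X lpa_path_mult_ghost_path(1)[OF p q]
        using deg monomial_in_free[OF lpa_path_mult_ghost_path(2,3)[OF p q]]
        by (intro imageI CollectI conjI)
          (auto simp: homogeneous_def word_degree_Word sum_list_degree_edges sum_list_degree_ghosts
            simp del: map_map)
    qed
  qed
  show "cls ` {x \<in> carrier F. homogeneous n x} \<subseteq> (lpa_component G n :: ('a, 'b, 'k) lpa set)"
    unfolding lpa_component_def linear_span_def
  proof (intro Inter_greatest subsetI; elim CollectE conjE imageE)
    fix W :: "('a, 'b, 'k) lpa set" and X and x :: "('a, 'b, 'k) lpa_free"
    assume W: "linear_subspace L W"
      and gens: "{lpa_path G u p \<otimes>\<^bsub>L\<^esub> lpa_ghost_path G u' q | u p v u' q v'.
        awalk u p v \<and> awalk u' q v' \<and> int (length p) - int (length q) = n} \<subseteq> W"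
      and X: "X = cls x" and x: "x \<in> carrier F" "homogeneous n x"
    have W0: "cls 0 \<in> W" and W_add: "\<And>x y. cls x \<in> W \<Longrightarrow> cls y \<in> W \<Longrightarrow> cls (x + y) \<in> W"
      and W_scalar: "\<And>c x. cls x \<in> W \<Longrightarrow> cls (scalar c * x) \<in> W"
      using W unfolding linear_subspace_def zero_L by (auto simp: add_L[symmetric] smult_L[symmetric])
    have "cls x \<in> W"
    proof (induction x rule: poly_mapping_linear_induct)
      case (single k c)
      obtain gs where k: "k = Word gs" by (cases k)
      have gs: "gs \<noteq> []" "set gs \<subseteq> lpa_gens G" "word_degree (Word gs) = n"
        using single x unfolding carrier_free_algebra homogeneous_def k by fastforce+
      have "(cls (monomial gs) :: ('a, 'b, 'k) lpa) \<in> W"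
        using word_eq_path_mult_ghost_path[OF gs(1,2)]
      proof (elim disjE exE conjE)
        assume "(cls (monomial gs) :: ('a, 'b, 'k) lpa) = cls 0"
        then show ?thesis using W0 by simp
      next
        fix p q u v w
        assume "awalk u p v" "awalk w q v" "int (length p) - int (length q) = word_degree (Word gs)"
          "(cls (monomial gs) :: ('a, 'b, 'k) lpa) = lpa_path G u p \<otimes>\<^bsub>L\<^esub> lpa_ghost_path G w q"
        then show ?thesis using gens gs(3) by blast
      qed
      then show ?case using W_scalar[of "monomial gs" c] by (simp add: k scalar_mult_single)
    qed (use W0 W_add in auto)
    then show "X \<in> W" by (simp add: X)
  qed
qed

text \<open>
  The relators are homogeneous, so the graded part of the relation ideal contains them and is the
  whole relation ideal. This is why the homogeneous components of the quotient are independent.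
\<close>

lemma component_R:
  assumes "x \<in> R" shows "component n x \<in> R"
proof -
  let ?J = "extend_ideal (lpa_gens G) (R :: ('a, 'b, 'c) lpa_free set)"
  interpret gr: lpa_congruence G "graded_part ?J"
    by (intro lpa_congruence_graded_part lpa_congruence_extend_ideal relation_ideal
        relators_in_relation_ideal)
  have "R \<subseteq> graded_part ?J \<inter> carrier F"
    using gr.J_relators lpa_relators_carrier
    by (intro relation_ideal_least two_sided_ideal_Int_carrier gr.J_ideal) blast
  then have "component n x \<in> ?J" using assms by (auto simp: graded_part_def)
  then show ?thesis using extend_ideal_iff[OF free_algebra_part[OF R_carrier[OF assms]]] by blast
qed

text \<open>
  Representatives of homogeneous classes can be chosen homogeneous, and two representatives of a class
  have the same components up to the relation ideal.
\<close>

lemma graded_ideal_image_iff: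
  fixes N :: "('a, 'b, 'k::field) lpa_free set"
  assumes N: "algebra_ideal F N" and rel: "lpa_relators G \<subseteq> N"
  shows "graded_ideal L (lpa_component G) (cls ` N) \<longleftrightarrow> (\<forall>x\<in>N. \<forall>n. component n x \<in> N)"
proof -
  note NN = N[unfolded algebra_ideal_free_algebra]
  have R: "R \<subseteq> N" by (rule relation_ideal_least[OF N rel])
  have NF: "x \<in> carrier F" if "x \<in> N" for x using NN that by blast
  have N_add: "x \<in> N \<Longrightarrow> y \<in> N \<Longrightarrow> x + y \<in> N" for x y using NN by blast
  have N_sum: "(\<And>i. i \<in> A \<Longrightarrow> f i \<in> N) \<Longrightarrow> (\<Sum>i\<in>A. f i) \<in> N" for A :: "int set" and f
    by (induction A rule: infinite_finite_induct) (use NN in auto)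
  define hom where "hom n = {x \<in> N. homogeneous n x}" for n
  have W: "cls ` N \<inter> lpa_component G n = cls ` hom n" for n
    unfolding lpa_component_eq
  proof (intro equalityI subsetI)
    fix X assume "X \<in> cls ` N \<inter> cls ` {x \<in> carrier F. homogeneous n x}"
    then obtain x where "X = cls x" "x \<in> carrier F" "homogeneous n x" "cls x \<in> cls ` N" by blast
    then show "X \<in> cls ` hom n" using ideal_image(2)[OF N rel] by (auto simp: hom_def)
  qed (use NF in \<open>auto simp: hom_def\<close>)
  have choose: "\<exists>f. (\<forall>n\<in>A. X n = cls (f n) \<and> f n \<in> N \<and> homogeneous n (f n)) \<and>
      (\<Oplus>\<^bsub>L\<^esub>n\<in>A. X n) = cls (\<Sum>n\<in>A. f n)"
    if "finite A" "\<forall>n\<in>A. X n \<in> cls ` hom n" for A :: "int set" and X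
  proof -
    from that(2) have "\<forall>n\<in>A. \<exists>x. X n = cls x \<and> x \<in> N \<and> homogeneous n x" by (auto simp: hom_def)
    then obtain f where f: "\<forall>n\<in>A. X n = cls (f n) \<and> f n \<in> N \<and> homogeneous n (f n)"
      by (meson bchoice)
    interpret L: abelian_monoid L by (rule abelian_monoid_L)
    have "(\<Oplus>\<^bsub>L\<^esub>n\<in>A. X n) = (\<Oplus>\<^bsub>L\<^esub>n\<in>A. cls (f n))"
      using f NF by (intro L.finsum_cong') (auto simp: carrier_L)
    also have "\<dots> = cls (\<Sum>n\<in>A. f n)" using f NF by (intro finsum_L that(1)) auto
    finally show ?thesis using f by blast
  qed
  have comp_sum: "component m (\<Sum>n\<in>A. f n) = (if m \<in> A then f m else 0)"
    if "finite A" "\<forall>n\<in>A. homogeneous n (f n)" for A :: "int set" and f m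
  proof -
    have "component m (\<Sum>n\<in>A. f n) = (\<Sum>n\<in>A. if n = m then f m else 0)"
      unfolding part_sum using that by (intro sum.cong) (auto simp: component_homogeneous)
    then show ?thesis using that by simp
  qed
  show ?thesis
  proof
    assume graded: "graded_ideal L (lpa_component G) (cls ` N)"
    show "\<forall>x\<in>N. \<forall>n. component n x \<in> N"
    proof (intro ballI allI)
      fix x m assume x: "x \<in> N"
      have "cls x \<in> {\<Oplus>\<^bsub>L\<^esub>n\<in>A. X n |A X. finite A \<and> (\<forall>n\<in>A. X n \<in> cls ` hom n)}"
        using graded x unfolding graded_ideal_def internal_direct_sum_def W by blast
      then obtain A X where A: "finite A" "\<forall>n\<in>A. X n \<in> cls ` hom n"
        and sum: "cls x = (\<Oplus>\<^bsub>L\<^esub>n\<in>A. X n)" by blast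
      from choose[OF A] obtain f where f: "\<forall>n\<in>A. X n = cls (f n) \<and> f n \<in> N \<and> homogeneous n (f n)"
        "cls x = cls (\<Sum>n\<in>A. f n)" using sum by auto
      have "component m (x - (\<Sum>n\<in>A. f n)) \<in> R"
        using f(2) by (intro component_R) (simp add: cls_eq_iff)
      then have "component m x - (if m \<in> A then f m else 0) \<in> N"
        using R comp_sum[of A f m] A(1) f(1) by auto
      moreover have "(if m \<in> A then f m else 0) \<in> N" using f NN by simp
      ultimately show "component m x \<in> N" using N_add by fastforce
    qed
  next
    assume closed: "\<forall>x\<in>N. \<forall>n. component n x \<in> N"
    show "graded_ideal L (lpa_component G) (cls ` N)"
      unfolding graded_ideal_def internal_direct_sum_def W
    proof (intro conjI allI impI ballI; (elim conjE)?)
      show "algebra_ideal L (cls ` N)" by (rule ideal_image(1)[OF N rel])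
      show "cls ` N = {\<Oplus>\<^bsub>L\<^esub>n\<in>A. X n |A X. finite A \<and> (\<forall>n\<in>A. X n \<in> cls ` hom n)}"
      proof (intro equalityI subsetI)
        fix X assume "X \<in> cls ` N"
        then obtain x where x: "X = cls x" "x \<in> N" by blast
        let ?A = "word_degree ` Poly_Mapping.keys x"
        have "X = (\<Oplus>\<^bsub>L\<^esub>n\<in>?A. cls (component n x))"
          using finsum_L[of ?A "\<lambda>n. component n x"] closed x NF by (simp add: sum_components)
        moreover have "\<forall>n\<in>?A. cls (component n x) \<in> cls ` hom n"
          using closed x by (auto simp: hom_def homogeneous_component)
        ultimately show "X \<in> {\<Oplus>\<^bsub>L\<^esub>n\<in>A. X n |A X. finite A \<and> (\<forall>n\<in>A. X n \<in> cls ` hom n)}"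
          by (intro CollectI exI[of _ ?A] exI[of _ "\<lambda>n. cls (component n x)"]) simp
      next
        fix X assume "X \<in> {\<Oplus>\<^bsub>L\<^esub>n\<in>A. X n |A X. finite A \<and> (\<forall>n\<in>A. X n \<in> cls ` hom n)}"
        then obtain A Y where "X = (\<Oplus>\<^bsub>L\<^esub>n\<in>A. Y n)" "finite A" "\<forall>n\<in>A. Y n \<in> cls ` hom n" by blast
        with choose[of A Y] N_sum[of A] show "X \<in> cls ` N" by auto
      qed
    next
      fix A X n
      assume A: "finite A" "\<forall>n\<in>A. X n \<in> cls ` hom n" and n: "n \<in> A"
        and zero: "(\<Oplus>\<^bsub>L\<^esub>n\<in>A. X n) = \<zero>\<^bsub>L\<^esub>"
      from choose[OF A] obtain f where f: "\<forall>n\<in>A. X n = cls (f n) \<and> f n \<in> N \<and> homogeneous n (f n)"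
        "cls 0 = cls (\<Sum>n\<in>A. f n)" using zero by (auto simp: zero_L)
      have "component n (\<Sum>n\<in>A. f n) \<in> R"
        using f(2)[symmetric] by (intro component_R) (simp add: cls_eq_iff)
      then have "f n \<in> R" using comp_sum[of A f n] A(1) f(1) n by simp
      then show "X n = \<zero>\<^bsub>L\<^esub>" using f(1) n by (simp add: zero_L cls_eq_iff)
    qed
  qed
qed

end

section \<open>Infinite paths that return to a vertex\<close>

context wf_digraph
begin

definition recurrent_paths :: "'a \<Rightarrow> (nat \<Rightarrow> 'b) set" where
  "recurrent_paths v = {q. (\<forall>n. q n \<in> arcs G \<and> head G (q n) = tail G (q (Suc n))) \<and>
     (\<forall>m. \<exists>n\<ge>m. tail G (q n) = v)}"

abbreviation shift :: "nat \<Rightarrow> (nat \<Rightarrow> 'b) \<Rightarrow> nat \<Rightarrow> 'b" where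
  "shift m q \<equiv> \<lambda>n. q (m + n)"

lemma shift_recurrent: "q \<in> recurrent_paths v \<Longrightarrow> shift m q \<in> recurrent_paths v"
proof -
  assume q: "q \<in> recurrent_paths v"
  have "\<exists>n\<ge>l. tail G (q (m + n)) = v" for l
  proof -
    from q obtain n where "n \<ge> m + l" "tail G (q n) = v" by (auto simp: recurrent_paths_def)
    then show ?thesis by (intro exI[of _ "n - m"]) auto
  qed
  then show ?thesis using q by (auto simp: recurrent_paths_def)
qed

lemma cons_recurrent:
  assumes q: "q \<in> recurrent_paths v" and e: "e \<in> arcs G" "head G e = tail G (q 0)"
  shows "case_nat e q \<in> recurrent_paths v"
proof -
  have "\<exists>n\<ge>m. tail G (case_nat e q n) = v" for m
  proof -
    from q obtain n where "n \<ge> m" "tail G (q n) = v" by (auto simp: recurrent_paths_def)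
    then show ?thesis by (intro exI[of _ "Suc n"]) auto
  qed
  then show ?thesis using q e by (auto simp: recurrent_paths_def split: nat.split)
qed

lemma recurrent_awalk:
  assumes "q \<in> recurrent_paths v"
  shows "awalk (tail G (q 0)) (map q [0..<n]) (tail G (q n))"
proof (induction n)
  case 0
  then show ?case using assms by (simp add: awalk_Nil_iff recurrent_paths_def)
next
  case (Suc n)
  have "awalk (tail G (q n)) [q n] (tail G (q (Suc n)))"
    using assms by (auto simp: awalk_Cons_iff awalk_Nil_iff recurrent_paths_def)
  with Suc show ?case by (simp add: awalk_appendI)
qed

lemma first_return:
  assumes q: "q \<in> recurrent_paths v" and start: "tail G (q 0) = v"
  shows "\<exists>n>0. simple_closed_path G v (map q [0..<n]) \<and> tail G (q n) = v"
proof -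
  define n where "n = (LEAST n. n > 0 \<and> tail G (q n) = v)"
  have "\<exists>n. n > 0 \<and> tail G (q n) = v"
  proof -
    from q obtain n where "n \<ge> 1" "tail G (q n) = v" by (auto simp: recurrent_paths_def)
    then show ?thesis by (intro exI[of _ n]) simp
  qed
  then have n: "n > 0" "tail G (q n) = v" unfolding n_def by (metis (mono_tags, lifting) LeastI_ex)+
  have "tail G (q i) \<noteq> v" if "0 < i" "i < n" for i
    using that not_less_Least unfolding n_def by blast
  moreover have "awalk v (map q [0..<n]) v" using recurrent_awalk[OF q, of n] start n by simp
  ultimately have "simple_closed_path G v (map q [0..<n])"
    using n start
    by (auto simp: simple_closed_path_def closed_path_def upt_conv_Cons)
  then show ?thesis using n by blast
qed

lemma periodic_recurrent:
  assumes p: "closed_path G v p"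
  shows "(\<lambda>n. p ! (n mod length p)) \<in> recurrent_paths v" and "tail G (p ! 0) = v"
proof -
  have ne: "p \<noteq> []" and walk: "awalk v p v" using p by (auto simp: closed_path_def)
  have cas: "head G (p ! i) = (if Suc i < length p then tail G (p ! Suc i) else w)"
    if "cas u p w" "i < length p" for i u w p
    using that
  proof (induction p arbitrary: u i)
    case (Cons e p)
    then show ?case
      by (cases i; cases p) auto
  qed simp
  show start: "tail G (p ! 0) = v" using walk ne by (cases p) (auto simp: awalk_Cons_iff)
  show "(\<lambda>n. p ! (n mod length p)) \<in> recurrent_paths v"
    unfolding recurrent_paths_def
  proof (intro CollectI conjI allI)
    fix n
    have lt: "n mod length p < length p" using ne by simp
    show "p ! (n mod length p) \<in> arcs G" using walk lt by (auto simp: awalk_def)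
    have "Suc n mod length p = (if Suc (n mod length p) < length p then Suc (n mod length p) else 0)"
      using lt by (auto simp: mod_Suc)
    then show "head G (p ! (n mod length p)) = tail G (p ! (Suc n mod length p))"
      using cas[of v p v "n mod length p"] walk lt start by (auto simp: awalk_def)
  next
    fix m
    show "\<exists>n\<ge>m. tail G (p ! (n mod length p)) = v"
      using start ne by (intro exI[of _ "m * length p"]) (simp add: Suc_le_eq)
  qed
qed

text \<open>
  Whenever the path is back at \<open>v\<close> for the first time it has run through a simple closed path, and so
  it consists of copies of \<open>c\<close>.
\<close>

lemma unique_return_periodic:
  assumes unique: "\<And>d. simple_closed_path G v d \<Longrightarrow> d = c"
    and q: "q \<in> recurrent_paths v" "tail G (q 0) = v"
  shows "map q [0..<length c] = c" and "shift (length c) q = q"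
proof -
  have prefix: "map q [0..<length c] = c \<and> tail G (q (length c)) = v \<and> length c > 0"
    if "q \<in> recurrent_paths v" "tail G (q 0) = v" for q
  proof -
    from first_return[OF that] obtain n
      where n: "n > 0" "simple_closed_path G v (map q [0..<n])" "tail G (q n) = v" by blast
    then have "map q [0..<n] = c" using unique by blast
    then show ?thesis using n by auto
  qed
  then show "map q [0..<length c] = c" using q by blast
  have "q i = c ! (i mod length c)" if "q \<in> recurrent_paths v" "tail G (q 0) = v" for q i
    using that
  proof (induction i arbitrary: q rule: less_induct)
    case (less i)
    note pre = prefix[OF less.prems]
    show ?case
    proof (cases "i < length c")
      case True
      then have "map q [0..<length c] ! i = q i" by simp
      then show ?thesis using True pre by simp
    next
      case False
      have "length c > 0" using pre by blast
      then have "i - length c < i" using False by arith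
      then have "shift (length c) q (i - length c) = c ! ((i - length c) mod length c)"
        using pre less.IH[of "i - length c" "shift (length c) q"] shift_recurrent[OF less.prems(1)]
        by simp
      then show ?thesis using False by (simp add: le_mod_geq)
    qed
  qed
  then have "q i = c ! (i mod length c)" for i using q by blast
  then show "shift (length c) q = q" by (intro ext) simp
qed

section \<open>The representation on functions of infinite paths\<close>

text \<open>
  This is the action dual to prefixing infinite paths by edges. The result at a path depends on
  the function at a single path, so that arbitrary functions can be allowed. All values outside the recurrent paths are 0,
  so that the relations hold identically and not only on recurrent paths.
\<close>

fun act :: "'a \<Rightarrow> ('a, 'b) lpa_gen \<Rightarrow> ((nat \<Rightarrow> 'b) \<Rightarrow> 'k::field) \<Rightarrow> (nat \<Rightarrow> 'b) \<Rightarrow> 'k" where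
  "act v (Vertex u) f q = (if q \<in> recurrent_paths v \<and> tail G (q 0) = u then f q else 0)"
| "act v (Edge e) f q = (if q \<in> recurrent_paths v \<and> q 0 = e then f (shift 1 q) else 0)"
| "act v (Ghost e) f q =
    (if q \<in> recurrent_paths v \<and> e \<in> arcs G \<and> head G e = tail G (q 0) then f (case_nat e q) else 0)"

definition act_word :: "'a \<Rightarrow> ('a, 'b) lpa_gen list \<Rightarrow> ((nat \<Rightarrow> 'b) \<Rightarrow> 'k::field) \<Rightarrow> (nat \<Rightarrow> 'b) \<Rightarrow> 'k" where
  "act_word v gs f = foldr (act v) gs f"

definition rep :: "'a \<Rightarrow> ('a, 'b, 'k::field) lpa_free \<Rightarrow> ((nat \<Rightarrow> 'b) \<Rightarrow> 'k) \<Rightarrow> (nat \<Rightarrow> 'b) \<Rightarrow> 'k" where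
  "rep v x f q = (\<Sum>k\<in>Poly_Mapping.keys x. Poly_Mapping.lookup x k * act_word v (letters k) f q)"

lemma act_linear: "act v g (\<lambda>q. a * f q + h q) = (\<lambda>q. a * act v g f q + act v g h q)"
  by (cases g) auto

lemma act_word_Nil: "act_word v [] f = f"
  and act_word_Cons: "act_word v (g # gs) f = act v g (act_word v gs f)"
  and act_word_append: "act_word v (gs @ hs) f = act_word v gs (act_word v hs f)"
  by (simp_all add: act_word_def)

lemma act_word_linear:
  "act_word v gs (\<lambda>q. a * f q + h q) = (\<lambda>q. a * act_word v gs f q + act_word v gs h q)"
  by (induction gs) (simp_all add: act_word_Nil act_word_Cons act_linear)

lemma rep_superset:
  assumes "finite A" "Poly_Mapping.keys x \<subseteq> A"
  shows "rep v x f q = (\<Sum>k\<in>A. Poly_Mapping.lookup x k * act_word v (letters k) f q)"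
  unfolding rep_def by (rule sum.mono_neutral_left) (use assms in \<open>auto simp: in_keys_iff\<close>)

lemma rep_zero: "rep v 0 f = (\<lambda>q. 0)"
  by (simp add: rep_def fun_eq_iff)

lemma rep_add: "rep v (x + y) f = (\<lambda>q. rep v x f q + rep v y f q)"
proof
  fix q
  let ?A = "Poly_Mapping.keys x \<union> Poly_Mapping.keys y"
  show "rep v (x + y) f q = rep v x f q + rep v y f q"
    using keys_add[of x y]
    by (simp add: rep_superset[of ?A] lookup_add distrib_right sum.distrib)
qed

lemma rep_single: "rep v (Poly_Mapping.single k c) f = (\<lambda>q. c * act_word v (letters k) f q)"
  by (simp add: rep_def fun_eq_iff)

lemma rep_uminus: "rep v (- x) f = (\<lambda>q. - rep v x f q)"
  using rep_add[of v x "- x" f] by (simp add: rep_zero fun_eq_iff add_eq_0_iff)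

lemma rep_diff: "rep v (x - y) f = (\<lambda>q. rep v x f q - rep v y f q)"
  using rep_add[of v x "- y" f] by (simp add: rep_uminus)

lemma rep_sum: "rep v (\<Sum>i\<in>A. x i) f = (\<lambda>q. \<Sum>i\<in>A. rep v (x i) f q)"
  by (induction A rule: infinite_finite_induct) (simp_all add: rep_zero rep_add)

lemma rep_linear: "rep v x (\<lambda>q. a * f q + h q) = (\<lambda>q. a * rep v x f q + rep v x h q)"
proof (induction x rule: poly_mapping_linear_induct)
  case (single k c)
  show ?case unfolding rep_single act_word_linear by (simp add: algebra_simps)
qed (simp_all add: rep_zero rep_add algebra_simps)

lemma rep_zero_fun: "rep v x (\<lambda>q. 0) = (\<lambda>q. 0)"
  \<comment> \<open>A value \<open>r\<close> with \<open>r = - r + r\<close> is 0.\<close>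
  using rep_linear[of v x "- 1" "\<lambda>q. 0" "\<lambda>q. 0"] by simp

lemma rep_single_mult: "rep v (Poly_Mapping.single k c * x) f = rep v (Poly_Mapping.single k c) (rep v x f)"
proof (induction x rule: poly_mapping_linear_induct)
  case zero
  show ?case by (simp add: rep_zero rep_zero_fun)
next
  case (add x y)
  have "rep v (Poly_Mapping.single k c) (\<lambda>q. 1 * rep v x f q + rep v y f q)
      = (\<lambda>q. 1 * rep v (Poly_Mapping.single k c) (rep v x f) q + rep v (Poly_Mapping.single k c) (rep v y f) q)"
    by (rule rep_linear)
  then show ?case by (simp add: distrib_left rep_add add)
next
  case (single l d)
  have "act_word v (letters k) (\<lambda>q. d * act_word v (letters l) f q + 0)
      = (\<lambda>q. d * act_word v (letters k) (act_word v (letters l) f) q + act_word v (letters k) (\<lambda>q. 0) q)"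
    by (rule act_word_linear)
  moreover have "act_word v (letters k) (\<lambda>q. 0) = (\<lambda>q. 0 :: 'c)"
    \<comment> \<open>A value \<open>r\<close> with \<open>r = - r + r\<close> is 0.\<close>
    using act_word_linear[of v "letters k" "- 1" "\<lambda>q. 0" "\<lambda>q. 0"] by simp
  ultimately show ?case
    by (simp add: mult_single rep_single plus_free_word_def act_word_append mult.assoc)
qed

lemma rep_mult: "rep v (x * y) f = rep v x (rep v y f)"
  by (induction x rule: poly_mapping_linear_induct)
    (simp_all add: rep_zero rep_add rep_single_mult distrib_right)

definition annihilator :: "'a \<Rightarrow> ('a, 'b, 'k::field) lpa_free set" where
  "annihilator v = {x. \<forall>f. rep v x f = (\<lambda>q. 0)}"

lemma two_sided_annihilator: "two_sided_ideal (annihilator v)"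
  by (simp add: two_sided_ideal_def annihilator_def rep_zero rep_add rep_mult rep_zero_fun)

text \<open>
  The relation at a regular vertex holds because an infinite path has exactly one first edge.
\<close>

lemma lpa_relators_annihilator: "lpa_relators G \<subseteq> annihilator v"
proof
  fix r :: "('a, 'b, 'k::field) lpa_free"
  assume "r \<in> lpa_relators G"
  note simps = annihilator_def rep_diff rep_single rep_zero act_word_Nil act_word_Cons fun_eq_iff
  have next_tail: "tail G (q (Suc 0)) = head G (q 0)" if "q \<in> recurrent_paths v" for q
    using that by (simp add: recurrent_paths_def)
  have cons: "case_nat e q \<in> recurrent_paths v"
    if "q \<in> recurrent_paths v" "e \<in> arcs G" "head G e = tail G (q 0)" for e q
    using cons_recurrent that by blast
  from \<open>r \<in> lpa_relators G\<close> show "r \<in> annihilator v"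
    unfolding lpa_relators_def
  proof (elim UnE CollectE exE conjE)
    fix u assume r: "r = monomial [Vertex u] - (\<Sum>e\<in>out_arcs G u. monomial [Edge e, Ghost e])"
      and u: "u \<in> regular_vertices G"
    have fin: "finite (out_arcs G u)" using u by (simp add: regular_vertices_def)
    have cons_shift: "case_nat (q 0) (shift 1 q) = q" for q :: "nat \<Rightarrow> 'b"
      by (auto simp: fun_eq_iff split: nat.split)
    have single: "rep v (monomial [Edge e, Ghost e]) f q
        = (if e = q 0 \<and> q \<in> recurrent_paths v then f q else 0)" for e q and f :: "(nat \<Rightarrow> 'b) \<Rightarrow> 'k"
      using cons_shift[of q] shift_recurrent[of q v 1] next_tail[of q]
      by (auto simp: rep_single act_word_Nil act_word_Cons recurrent_paths_def)
    have "rep v (\<Sum>e\<in>out_arcs G u. monomial [Edge e, Ghost e]) f q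
        = (if q \<in> recurrent_paths v \<and> tail G (q 0) = u then f q else 0)" for q and f :: "(nat \<Rightarrow> 'b) \<Rightarrow> 'k"
    proof -
      have "rep v (\<Sum>e\<in>out_arcs G u. monomial [Edge e, Ghost e]) f q
          = (\<Sum>e\<in>out_arcs G u. if e = q 0 then (if q \<in> recurrent_paths v then f q else 0) else 0)"
        unfolding rep_sum single by (intro sum.cong) auto
      also have "\<dots> = (if q 0 \<in> out_arcs G u then (if q \<in> recurrent_paths v then f q else 0) else 0)"
        using fin by (simp add: sum.delta)
      also have "\<dots> = (if q \<in> recurrent_paths v \<and> tail G (q 0) = u then f q else 0)"
        by (auto simp: recurrent_paths_def)
      finally show ?thesis .
    qed
    then show ?thesis by (simp add: r simps)
  qed (auto simp: simps next_tail cons shift_recurrent[of _ v 1, simplified])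
qed

lemma act_word_path:
  assumes q: "q \<in> recurrent_paths v"
  shows "act_word v (map Edge p) f q = (if map q [0..<length p] = p then f (shift (length p) q) else 0)"
  using q
proof (induction p arbitrary: q)
  case Nil
  then show ?case by (simp add: act_word_Nil)
next
  case (Cons e p)
  have "map q [0..<length (e # p)] = q 0 # map (shift 1 q) [0..<length p]"
    by (simp add: upt_conv_Cons map_Suc_upt[symmetric] del: upt_Suc)
  then show ?case
    using Cons.prems Cons.IH[OF shift_recurrent[OF Cons.prems, of 1]]
    by (auto simp: act_word_Cons)
qed

text \<open>
  The ideal is the annihilator of the representation at a vertex \<open>v\<close> with one simple closed path \<open>c\<close>
  only, and the element is \<open>v - c\<close>. The periodic path \<open>p p p \<dots>\<close> for a closed path \<open>p\<close> at \<open>v\<close> provides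
  the infinite path on which \<open>v\<close> does not act as 0, and its first return provides \<open>c\<close>.
\<close>

lemma not_condition_K_component_open:
  assumes "\<not> condition_K G"
  shows "\<exists>(N :: ('a, 'b, 'k::field) lpa_free set) x n. algebra_ideal F N \<and> lpa_relators G \<subseteq> N \<and>
    x \<in> N \<and> component n x \<notin> N"
proof -
  from assms obtain v p where v: "v \<in> verts G" and p: "closed_path G v p"
    and unique: "\<And>c d. simple_closed_path G v c \<Longrightarrow> simple_closed_path G v d \<Longrightarrow> c = d"
    unfolding condition_K_def by blast
  define q where "q = (\<lambda>n. p ! (n mod length p))"
  have q: "q \<in> recurrent_paths v" "tail G (q 0) = v"
    using periodic_recurrent[OF p] by (simp_all add: q_def)
  from first_return[OF q] obtain c where c: "simple_closed_path G v c" by blast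
  have c_ne: "c \<noteq> []" and c_walk: "awalk v c v" using simple_closed_path_awalk[OF c] by blast+
  define N :: "('a, 'b, 'k) lpa_free set" where "N = annihilator v \<inter> carrier F"
  define x :: "('a, 'b, 'k) lpa_free" where "x = vertex_el v - monomial (map Edge c)"
  have "Edge ` set c \<subseteq> lpa_gens G" using c_walk unfolding lpa_gens_def awalk_def by blast
  then have in_F: "(vertex_el v :: ('a, 'b, 'k) lpa_free) \<in> carrier F"
    "(monomial (map Edge c) :: ('a, 'b, 'k) lpa_free) \<in> carrier F"
    using v c_ne by (simp_all add: monomial_in_free lpa_gens_def)
  have "x \<in> annihilator v"
    unfolding annihilator_def
  proof (intro CollectI allI ext)
    fix f :: "(nat \<Rightarrow> 'b) \<Rightarrow> 'k" and r
    obtain e c' where ec: "c = e # c'" "tail G e = v"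
      using c_ne c_walk by (cases c) (auto simp: awalk_Cons_iff)
    consider "r \<notin> recurrent_paths v" | "r \<in> recurrent_paths v" "tail G (r 0) \<noteq> v"
      | "r \<in> recurrent_paths v" "tail G (r 0) = v" by blast
    then show "rep v x f r = 0"
    proof cases
      case 1
      then show ?thesis by (simp add: x_def rep_diff rep_single act_word_Nil act_word_Cons ec)
    next
      case 2
      then show ?thesis using ec
        by (auto simp: x_def rep_diff rep_single act_word_Nil act_word_Cons)
    next
      case 3
      then show ?thesis
        using unique_return_periodic[OF unique[OF _ c] 3]
        by (simp add: x_def rep_diff rep_single act_word_path act_word_Nil act_word_Cons)
    qed
  qed
  moreover have "x \<in> carrier F" unfolding x_def by (intro free_algebra_diff in_F)
  ultimately have "x \<in> N" by (simp add: N_def)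
  have "component 0 x = vertex_el v"
    using c_ne by (simp add: x_def part_single word_degree_Word sum_list_degree_edges del: map_map)
  moreover have "rep v (vertex_el v) (\<lambda>_. 1) q = (1 :: 'k)"
    using q by (simp add: rep_single act_word_Nil act_word_Cons)
  then have "vertex_el v \<notin> N"
    by (auto simp: N_def annihilator_def fun_eq_iff)
  ultimately have "component 0 x \<notin> N" by simp
  moreover have "algebra_ideal F N"
    unfolding N_def by (rule two_sided_ideal_Int_carrier[OF two_sided_annihilator])
  moreover have "lpa_relators G \<subseteq> N"
    unfolding N_def using lpa_relators_annihilator lpa_relators_carrier by blast
  ultimately show ?thesis using \<open>x \<in> N\<close> by blast
qed

end

section \<open>Condition (K) and graded ideals\<close>

theorem theorem6p16:
  fixes E :: "('v, 'e) pre_digraph"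
  assumes "wf_digraph E" and "countable (verts E)" and "countable (arcs E)"
  shows "condition_K E \<longleftrightarrow>
    (\<forall>I :: ('v, 'e, 'k::field) lpa set.
       algebra_ideal (leavitt_path_algebra E) I \<longrightarrow>
       graded_ideal (leavitt_path_algebra E) (lpa_component E) I)"
proof -
  interpret wf_digraph E by (rule assms(1))
  show ?thesis
  proof
    assume K: "condition_K E"
    show "\<forall>I :: ('v, 'e, 'k) lpa set. algebra_ideal L I \<longrightarrow> graded_ideal L (lpa_component E) I"
    proof (intro allI impI)
      fix I :: "('v, 'e, 'k) lpa set" assume I: "algebra_ideal L I"
      define N where "N = {x \<in> carrier F. cls x \<in> I}"
      note N = ideal_preimage[OF I, folded N_def]
      have NF: "N \<subseteq> carrier F" by (auto simp: N_def)
      have "component n x \<in> N" if "x \<in> N" for x n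
      proof -
        have x: "x \<in> carrier F" using that NF by blast
        have "component n x \<in> extend_ideal (lpa_gens E) N"
          using that x
          by (intro condition_K_component_closed[OF lpa_congruence_extend_ideal[OF N(1,2)] K])
            (simp_all add: extend_ideal_iff)
        then show ?thesis using x by (simp add: extend_ideal_iff free_algebra_part)
      qed
      then show "graded_ideal L (lpa_component E) I"
        using graded_ideal_image_iff[OF N(1,2)] N(3) by simp
    qed
  next
    assume graded: "\<forall>I :: ('v, 'e, 'k) lpa set. algebra_ideal L I \<longrightarrow> graded_ideal L (lpa_component E) I"
    show "condition_K E"
    proof (rule ccontr)
      assume "\<not> condition_K E"
      then obtain N :: "('v, 'e, 'k) lpa_free set" and x n
        where N: "algebra_ideal F N" "lpa_relators E \<subseteq> N" and "x \<in> N" "component n x \<notin> N"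
        using not_condition_K_component_open by blast
      with graded_ideal_image_iff[OF N] ideal_image(1)[OF N] graded show False by blast
    qed
  qed
qed

end
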